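(* Let $\mathbb K$ be an algebraically closed field of characteristic $0$ and $R=\mathbb K[x,y,z]$. Let $I=(l_1^d,\dots,l_{2d+1}^d)\subset R$ be an artinian ideal generated by $2d+1$ distinct powers of linear forms in $\mathbb P^2$ (the $l_i$ pairwise non-proportional). Let $Z=\{l_1^\vee,\dots,l_{2d+1}^\vee\}$ be the corresponding set of points in the dual plane $\mathbb P^{2\vee}$. If there are no more than $d+1$ aligned points in $Z$, then the following are equivalent: 1. $Z$ has an unexpected curve of degree $d$; 2. $I$ fails the SLP in range $2$ and degree $d-2$; 3. the variety $\pi_{I_d}(v_d(\mathbb P^2))$ satisfies at least one non-trivial Laplace equation of order $d-2$.
   Context: For a nonzero linear form $l$, $l^\vee\in\mathbb P^{2\vee}$ is the point dual to the line $l=0$. Aligned points are points lying on a common line. Unexpected curve. A reduced finite set of points $Z$ in a projective plane admits an unexpected curve of degree $j+1$ (where $j>0$ is an integer) if, for a general point $P$, $$h^0\big((\mathcal I_Z\otimes\mathcal I_P^{\,j})(j+1)\big)>\max\left\{h^0(\mathcal I_Z(j+1))-\binom{j+1}{2},\,0\right\},$$ where $\mathcal I_Z,\mathcal I_P$ are the ideal sheaves of $Z$ and $P$. SLP. $I$ fails the Strong Lefschetz Property (SLP) at range $k$ in degree $t$ if for a general (equivalently, every) linear form $L$ the multiplication map $\times L^k\colon (R/I)_t\to(R/I)_{t+k}$ does not have maximal rank, i.e. is neither injective nor surjective. Projected Veronese. $v_d\colon[L]\mapsto[L^d]$ is the $d$-uple Veronese embedding of $\mathbb P^2=\{[L]:0\ne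 L\in R_1\}$ into the projective space of lines in $R_d$. The map $\pi_{I_d}$ is the linear projection centred at the projective space of lines in $I_d$ (the degree $d$ component of $I$), onto the projective space of lines in $R_d/I_d$; thus $\pi_{I_d}(v_d(\mathbb P^2))$ is the image of $[L]\mapsto[L^d\bmod I_d]$, in $\mathbb P^N$ with $N=\dim_{\mathbb K}(R_d/I_d)-1$. Laplace equations. For a surface $X\subset\mathbb P^N$ the $m$-th osculating space $T_P^m(X)$ at a general point $P$ is the linear subspace of $\mathbb P^N$ spanned by $P$ and by all derivative points of order $\le m$ of a local parametrization of $X$, evaluated at $P$. Its expected dimension is $\operatorname{expdim}T_P^m(X)=\min\left(\binom{m+2}{2}-1,N\right)$. $X$ satisfies $\delta$ independent (non-trivial) Laplace equations of order $m$ if $\dim T_P^m(X)=\operatorname{expdim}T_P^m(X)-\delta$ at a general point $P$; "at least one" means $\delta\ge1$. (For $m=0$ the osculating space is $\{P\}$; there are no Laplace equations of negative order.) *)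

theory Defs
  imports
    "HOL-Analysis.Analysis"
    "HOL-Library.Poly_Mapping"
    "HOL-Computational_Algebra.Computational_Algebra"
begin

section \<open>The graded ring of ternary polynomials\<close>

text \<open>Exponents are finitely supported maps on the three-element type \<open>3\<close>, so that
  \<open>'k ternary\<close> is the polynomial ring in three variables and \<open>'k ^ 3\<close> is the space of
  homogeneous coordinate vectors.\<close>

type_synonym 'k ternary = "(3 \<Rightarrow>\<^sub>0 nat) \<Rightarrow>\<^sub>0 'k"

definition const :: "'k::field \<Rightarrow> 'k ternary" where
  "const c = Poly_Mapping.single 0 c"

definition var :: "3 \<Rightarrow> 'k::field ternary" where
  "var i = Poly_Mapping.single (Poly_Mapping.single i 1) 1"

definition scale :: "'k::field \<Rightarrow> 'k ternary \<Rightarrow> 'k ternary" where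
  "scale c f = const c * f"

definition eval :: "'k::field ternary \<Rightarrow> 'k ^ 3 \<Rightarrow> 'k" where
  "eval f p = (\<Sum>m\<in>Poly_Mapping.keys f.
     Poly_Mapping.lookup f m * (\<Prod>i\<in>UNIV. (p $ i) ^ Poly_Mapping.lookup m i))"

text \<open>Degrees are integers; the graded pieces of negative degree are zero.\<close>

definition forms :: "int \<Rightarrow> 'k::field ternary set" where
  "forms t = {f. \<forall>m\<in>Poly_Mapping.keys f. int (\<Sum>i\<in>UNIV. Poly_Mapping.lookup m i) = t}"

definition linear_form :: "'k::field ^ 3 \<Rightarrow> 'k ternary" where
  "linear_form a = (\<Sum>i\<in>UNIV. scale (a $ i) (var i))"

text \<open>Coordinates of the point of the dual plane that is dual to the line \<open>l = 0\<close>.\<close>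

definition dual_point :: "'k::field ternary \<Rightarrow> 'k ^ 3" where
  "dual_point l = (\<chi> i. Poly_Mapping.lookup l (Poly_Mapping.single i 1))"

global_interpretation polys: vector_space "scale :: 'k::field \<Rightarrow> 'k ternary \<Rightarrow> 'k ternary"
  by unfold_locales
    (simp_all add: scale_def const_def algebra_simps single_add mult_single flip: mult.assoc)

global_interpretation ideal: module "(*) :: 'r::comm_ring_1 \<Rightarrow> 'r \<Rightarrow> 'r"
  by unfold_locales (simp_all add: algebra_simps)

text \<open>The submodules of a ring over itself are its ideals: \<open>ideal.subspace J\<close> says that
  \<open>J\<close> is an ideal, and \<open>ideal.span S\<close> is the ideal generated by \<open>S\<close>.\<close>

definition ideal_prod :: "'r::comm_ring_1 set \<Rightarrow> 'r set \<Rightarrow> 'r set" where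
  "ideal_prod I J = ideal.span {a * b | a b. a \<in> I \<and> b \<in> J}"

primrec ideal_power :: "'r::comm_ring_1 set \<Rightarrow> nat \<Rightarrow> 'r set" where
  "ideal_power I 0 = UNIV"
| "ideal_power I (Suc n) = ideal_prod I (ideal_power I n)"

text \<open>The quotient ring by \<open>I\<close> is artinian (descending chain condition on the ideals
  containing \<open>I\<close>).\<close>

definition artinian_ideal :: "'r::comm_ring_1 set \<Rightarrow> bool" where
  "artinian_ideal I \<longleftrightarrow> ideal.subspace I \<and>
     (\<forall>J :: nat \<Rightarrow> 'r set.
        (\<forall>n. ideal.subspace (J n) \<and> I \<subseteq> J n \<and> J (Suc n) \<subseteq> J n) \<longrightarrow>
        (\<exists>n. \<forall>m\<ge>n. J m = J n))"

text \<open>The dimension of the image of \<open>V\<close> in the quotient by \<open>W\<close>, for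
  finite-dimensional subspaces \<open>V\<close> and \<open>W\<close>.\<close>

definition dim_mod :: "'k::field ternary set \<Rightarrow> 'k ternary set \<Rightarrow> nat" where
  "dim_mod V W = polys.dim (V \<union> W) - polys.dim W"


section \<open>The projective plane\<close>

text \<open>Points are given by nonzero coordinate vectors, up to proportionality.
  A property holds for a general point if it holds on a nonempty Zariski open subset.\<close>

definition zariski_closed :: "('k::field ^ 3) set \<Rightarrow> bool" where
  "zariski_closed C \<longleftrightarrow>
     (\<exists>S. (\<forall>f\<in>S. \<exists>t. f \<in> forms t) \<and> C = {p. p \<noteq> 0 \<and> (\<forall>f\<in>S. eval f p = 0)})"

definition general_point :: "('k::field ^ 3 \<Rightarrow> bool) \<Rightarrow> bool" where
  "general_point Q \<longleftrightarrow>
     (\<exists>C. zariski_closed C \<and> C \<noteq> {p. p \<noteq> 0} \<and> (\<forall>p. p \<noteq> 0 \<and> p \<notin> C \<longrightarrow> Q p))"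

definition aligned :: "('k::field ^ 3) set \<Rightarrow> bool" where
  "aligned S \<longleftrightarrow> (\<exists>l\<in>forms 1. l \<noteq> 0 \<and> (\<forall>p\<in>S. eval l p = 0))"


section \<open>Unexpected curves\<close>

definition vanishing_ideal :: "('k::field ^ 3) set \<Rightarrow> 'k ternary set" where
  "vanishing_ideal Z = ideal.span {f. (\<exists>t. f \<in> forms t) \<and> (\<forall>p\<in>Z. eval f p = 0)}"

text \<open>Global sections of the twist by \<open>e\<close> of the ideal sheaf associated with the homogeneous
  ideal \<open>J\<close>: forms of degree \<open>e\<close> that belong to \<open>J\<close> locally around every point \<open>q\<close> of the
  plane, i.e. after multiplication by a form that does not vanish at \<open>q\<close>.\<close>

definition sections :: "'k::field ternary set \<Rightarrow> int \<Rightarrow> 'k ternary set" where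
  "sections J e =
     {f \<in> forms e. \<forall>q. q \<noteq> 0 \<longrightarrow> (\<exists>t. \<exists>g\<in>forms t. eval g q \<noteq> 0 \<and> g * f \<in> J)}"

definition h0 :: "'k::field ternary set \<Rightarrow> int \<Rightarrow> nat" where
  "h0 J e = polys.dim (sections J e)"

text \<open>For \<open>p \<notin> Z\<close>, hence for general \<open>p\<close>, the tensor product of the ideal sheaf of \<open>Z\<close> with
  the \<open>j\<close>-th power of the ideal sheaf of \<open>p\<close> is the product of these ideal sheaves.\<close>

definition admits_unexpected_curve :: "('k::field ^ 3) set \<Rightarrow> nat \<Rightarrow> bool" where
  "admits_unexpected_curve Z e \<longleftrightarrow>
     (\<exists>j>0. e = j + 1 \<and>
       general_point (\<lambda>p.
         int (h0 (ideal_prod (vanishing_ideal Z) (ideal_power (vanishing_ideal {p}) j))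
               (int (j + 1)))
         > max (int (h0 (vanishing_ideal Z) (int (j + 1))) - int ((j + 1) choose 2)) 0))"


section \<open>The strong Lefschetz property\<close>

text \<open>Injectivity and surjectivity of multiplication by \<open>f\<close> from degree \<open>s\<close> to degree \<open>t\<close> of the
  quotient by the homogeneous ideal \<open>I\<close>, written out on representatives.\<close>

definition mult_inj :: "'k::field ternary set \<Rightarrow> 'k ternary \<Rightarrow> int \<Rightarrow> bool" where
  "mult_inj I f s \<longleftrightarrow>
     (\<forall>g\<in>forms s. \<forall>h\<in>forms s. f * g - f * h \<in> I \<longrightarrow> g - h \<in> I)"

definition mult_surj :: "'k::field ternary set \<Rightarrow> 'k ternary \<Rightarrow> int \<Rightarrow> int \<Rightarrow> bool" where
  "mult_surj I f s t \<longleftrightarrow> (\<forall>h\<in>forms t. \<exists>g\<in>forms s. h - f * g \<in> I)"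

definition fails_SLP :: "'k::field ternary set \<Rightarrow> nat \<Rightarrow> int \<Rightarrow> bool" where
  "fails_SLP I k t \<longleftrightarrow>
     general_point (\<lambda>a. \<not> mult_inj I (linear_form a ^ k) t \<and>
                        \<not> mult_surj I (linear_form a ^ k) t (t + int k))"


section \<open>Osculating spaces and Laplace equations of the projected Veronese surface\<close>

text \<open>If \<open>L0\<close>, \<open>L1\<close>, \<open>L2\<close> is a basis of the linear forms, then
  \<open>(u, v) \<mapsto> [L0 + u L1 + v L2]\<close> is an affine chart of the plane centred at \<open>[L0]\<close>, and
  \<open>(u, v) \<mapsto> [(L0 + u L1 + v L2) ^ d mod I]\<close> is the induced local parametrization of the
  projected Veronese surface. Below it is lifted to a polynomial in \<open>u\<close> (inner variable) and
  \<open>v\<close> (outer variable) with coefficients in the forms of degree \<open>d\<close>; the reduction modulo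
  \<open>I\<close> takes place in \<open>osculating_dim\<close>.\<close>

definition veronese_param ::
    "nat \<Rightarrow> 'k::field ternary \<Rightarrow> 'k ternary \<Rightarrow> 'k ternary \<Rightarrow> 'k ternary poly poly" where
  "veronese_param d L0 L1 L2 = [:[:L0, L1:], [:L2:]:] ^ d"

text \<open>The derivative of order \<open>i\<close> in \<open>u\<close> and \<open>j\<close> in \<open>v\<close> at the centre of the chart.\<close>

definition deriv_point :: "'k::field ternary poly poly \<Rightarrow> nat \<Rightarrow> nat \<Rightarrow> 'k ternary" where
  "deriv_point F i j = poly (poly ((pderiv ^^ j) ((map_poly pderiv ^^ i) F)) 0) 0"

text \<open>Dimensions of projective subspaces are one less than those of the corresponding linear
  subspaces of the degree \<open>d\<close> piece of the quotient by \<open>I\<close>.\<close>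

definition osculating_dim ::
    "'k::field ternary set \<Rightarrow> nat \<Rightarrow> 'k ternary poly poly \<Rightarrow> nat \<Rightarrow> int" where
  "osculating_dim I d F m =
     int (dim_mod (polys.span {deriv_point F i j | i j. i + j \<le> m}) (I \<inter> forms (int d))) - 1"

definition ambient_dim :: "'k::field ternary set \<Rightarrow> nat \<Rightarrow> int" where
  "ambient_dim I d = int (dim_mod (forms (int d)) (I \<inter> forms (int d))) - 1"

definition osculating_expdim :: "'k::field ternary set \<Rightarrow> nat \<Rightarrow> nat \<Rightarrow> int" where
  "osculating_expdim I d m = min (int ((m + 2) choose 2) - 1) (ambient_dim I d)"

definition satisfies_laplace :: "'k::field ternary set \<Rightarrow> nat \<Rightarrow> nat \<Rightarrow> int \<Rightarrow> bool" where
  "satisfies_laplace I d \<delta> m \<longleftrightarrow> m \<ge> 0 \<and>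
     general_point (\<lambda>a. \<forall>L1 L2. polys.span {linear_form a, L1, L2} = forms 1 \<longrightarrow>
       osculating_dim I d (veronese_param d (linear_form a) L1 L2) (nat m)
         = osculating_expdim I d (nat m) - int \<delta>)"

end

theory Submission
  imports Defs
begin

text \<open>By apolarity, the forms of degree \<open>d\<close> vanishing on \<open>Z\<close> are the orthogonal space of
  \<open>I\<^sub>d\<close>, and the forms of degree \<open>d\<close> with multiplicity at least \<open>d - 1\<close> at \<open>p\<close>, which are
  those killed by the square of the derivation in direction \<open>p\<close>, are the orthogonal space of
  \<open>L\<^sup>2 R\<^sub>d\<^sub>-\<^sub>2\<close>, where \<open>L\<close> is the linear form with coefficient vector \<open>p\<close>. The
  space \<open>L\<^sup>2 R\<^sub>d\<^sub>-\<^sub>2\<close> is also spanned by the derivatives of order at most \<open>d - 2\<close> of the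
  Veronese parametrization at \<open>L\<close>. So each of the three conditions says that
  \<open>dim (I\<^sub>d + L\<^sup>2 R\<^sub>d\<^sub>-\<^sub>2)\<close> is smaller than expected for general \<open>p\<close>; in the Laplace
  condition the defect has to be the same for general \<open>p\<close>, which holds because this dimension
  is lower semicontinuous in \<open>p\<close>.\<close>

text \<open>The three expected values agree because, with \<open>n = d - 2\<close>, the number
  \<open>(n + 2) choose 2\<close> counts three things at once: the dimension of the forms of degree
  \<open>n\<close>, the conditions imposed by a point of multiplicity \<open>n + 1 = d - 1\<close>,
  and the derivatives of order at most \<open>n\<close> in two variables. Orthogonality replaces a
  dimension by its complement, so the maximum in the definition of unexpectedness turns into the
  minimum of two upper bounds on a rank. The main obstacle is that sections are defined locally
  while apolarity speaks of forms. A multiplicity at \<open>p\<close> must be recognized after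
  multiplication by a form that does not vanish at \<open>p\<close>; higher derivatives do this, and
  Euler's identity leads back from derivatives to powers of the ideal of \<open>p\<close>.
  Characteristic 0 makes the factorials in the pairing and the degrees in Euler's identity
  invertible. The degree of the powers is written \<open>n + k\<close> with a variable range
  \<open>k\<close>; the value \<open>k = 2\<close> is inserted only at the end.\<close>

text \<open>Oriented against \<open>mult.assoc\<close>: as simp rules the two loop.\<close>

declare ideal.scale_scale [simp del]

section \<open>Coefficients, evaluation and graded pieces\<close>

abbreviation lookup :: "('a \<Rightarrow>\<^sub>0 'b::zero) \<Rightarrow> 'a \<Rightarrow> 'b" where
  "lookup \<equiv> Poly_Mapping.lookup"

abbreviation keys :: "('a \<Rightarrow>\<^sub>0 'b::zero) \<Rightarrow> 'a set" where
  "keys \<equiv> Poly_Mapping.keys"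

abbreviation single :: "'a \<Rightarrow> 'b \<Rightarrow> 'a \<Rightarrow>\<^sub>0 'b::zero" where
  "single \<equiv> Poly_Mapping.single"

definition exponent :: "3 \<Rightarrow> 3 \<Rightarrow>\<^sub>0 nat" where
  "exponent i = single i 1"

lemma lookup_exponent [simp]: "lookup (exponent i) j = (if i = j then 1 else 0)"
  by (simp add: exponent_def lookup_single when_def)

lemma exponent_eq_iff [simp]: "exponent i = exponent j \<longleftrightarrow> i = j"
  by (metis lookup_exponent zero_neq_one)

lemma var_eq: "var i = single (exponent i) 1"
  by (simp add: var_def exponent_def)

lemma dual_point_nth: "dual_point l $ i = lookup l (exponent i)"
  by (simp add: dual_point_def exponent_def)

definition total_degree :: "(3 \<Rightarrow>\<^sub>0 nat) \<Rightarrow> nat" where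
  "total_degree m = (\<Sum>i\<in>UNIV. lookup m i)"

lemma total_degree_add: "total_degree (m + n) = total_degree m + total_degree n"
  by (simp add: total_degree_def lookup_add sum.distrib)

lemma total_degree_zero [simp]: "total_degree 0 = 0"
  by (simp add: total_degree_def)

lemma total_degree_eq_0_iff: "total_degree m = 0 \<longleftrightarrow> m = 0"
  unfolding total_degree_def by (auto intro!: poly_mapping_eqI)

lemma total_degree_exponent [simp]: "total_degree (exponent i) = 1"
  by (simp add: total_degree_def)

lemma exponent_remove: "lookup m i > 0 \<Longrightarrow> m - exponent i + exponent i = m"
  by (rule poly_mapping_eqI) (auto simp: lookup_add lookup_minus lookup_single when_def)

lemma poly_mapping_sum_single:
  fixes f :: "'a \<Rightarrow>\<^sub>0 'b::comm_monoid_add"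
  shows "f = (\<Sum>m\<in>keys f. single m (lookup f m))"
proof (rule poly_mapping_eqI)
  fix n
  show "lookup f n = lookup (\<Sum>m\<in>keys f. single m (lookup f m)) n"
    by (simp add: lookup_sum lookup_single when_def in_keys_iff)
qed

text \<open>Multiplicativity of \<open>eval\<close>, the Leibniz rule for \<open>pd\<close> and the
  adjointness of the pairing are additive in each argument, so this reduces them to single
  terms.\<close>

lemma poly_mapping_single_induct [case_names single add]:
  fixes f :: "'a \<Rightarrow>\<^sub>0 'b::comm_monoid_add"
  assumes "\<And>m c. P (single m c)" and "\<And>f g. P f \<Longrightarrow> P g \<Longrightarrow> P (f + g)"
  shows "P f"
proof -
  have "P (\<Sum>m\<in>A. single m (lookup f m))" if "finite A" for A
    using that
  proof (induction A)
    case empty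
    show ?case using assms(1)[of undefined 0] by simp
  next
    case (insert a A)
    then show ?case by (simp add: assms)
  qed
  from this[OF finite_keys[of f]] show ?thesis unfolding poly_mapping_sum_single[of f, symmetric] .
qed

lemma single_times_lookup:
  "lookup (single m c * f) (m + n) = c * lookup (f :: ('a::cancel_comm_monoid_add) \<Rightarrow>\<^sub>0 'b::comm_semiring_1) n"
  by (induction f rule: poly_mapping_single_induct)
    (simp_all add: mult_single lookup_single when_def distrib_left lookup_add)

lemma lookup_scale [simp]: "lookup (scale c f) m = c * lookup f m"
  using single_times_lookup[of 0 c f m] by (simp add: scale_def const_def)

lemma scale_single: "scale c (single m e) = single m (c * e)"
  by (simp add: scale_def const_def mult_single)

lemma scale_times_left [simp]: "scale c f * g = scale c (f * g)"
  by (simp add: scale_def mult.assoc)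

lemma scale_times_right [simp]: "f * scale c g = scale c (f * g)"
  by (simp add: scale_def mult.left_commute)

text \<open>Different polynomials have different supports; a common finite index set lets their sums
  be compared term by term.\<close>

lemma eval_superset:
  assumes "finite A" "keys f \<subseteq> A"
  shows "eval f p = (\<Sum>m\<in>A. lookup f m * (\<Prod>i\<in>UNIV. (p $ i) ^ lookup m i))"
  unfolding eval_def using assms
  by (intro sum.mono_neutral_left) (auto simp: in_keys_iff)

lemma eval_zero [simp]: "eval 0 p = 0"
  by (simp add: eval_def)

lemma eval_add [simp]: "eval (f + g) p = eval f p + eval g p"
proof -
  have "finite (keys f \<union> keys g)" by simp
  from eval_superset[OF this, of f p] eval_superset[OF this, of g p]
    eval_superset[OF this keys_add, of p]
  show ?thesis by (simp add: lookup_add algebra_simps sum.distrib)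
qed

lemma eval_single: "eval (single m c) p = c * (\<Prod>i\<in>UNIV. (p $ i) ^ lookup m i)"
  by (subst eval_superset[of "{m}"]) auto

lemma eval_times [simp]: "eval (f * g) p = eval f p * eval g p"
proof (induction f rule: poly_mapping_single_induct)
  case (single m c)
  show ?case
    by (induction g rule: poly_mapping_single_induct)
      (simp_all add: mult_single eval_single lookup_add power_add prod.distrib algebra_simps)
qed (simp add: algebra_simps)

lemma eval_const [simp]: "eval (const c) p = c"
  by (simp add: const_def eval_single)

lemma eval_one [simp]: "eval 1 p = 1"
  using eval_const[of 1 p] by (simp add: const_def)

lemma eval_scale [simp]: "eval (scale c f) p = c * eval f p"
  by (simp add: scale_def)

lemma eval_uminus [simp]: "eval (- f) p = - eval f p"
  using eval_add[of f "- f" p] by (simp add: eq_neg_iff_add_eq_0 add.commute del: eval_add)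

lemma eval_diff [simp]: "eval (f - g) p = eval f p - eval g p"
  using eval_add[of f "- g" p] by simp

lemma eval_sum [simp]: "eval (sum f A) p = (\<Sum>i\<in>A. eval (f i) p)"
  by (induction A rule: infinite_finite_induct) auto

lemma eval_prod [simp]: "eval (prod f A) p = (\<Prod>i\<in>A. eval (f i) p)"
  by (induction A rule: infinite_finite_induct) auto

lemma eval_power [simp]: "eval (f ^ n) p = eval f p ^ n"
  by (induction n) auto

lemma eval_var [simp]: "eval (var i) p = p $ i"
proof -
  have "(\<Prod>j\<in>UNIV. (p $ j) ^ lookup (exponent i) j) = (\<Prod>j\<in>UNIV. if j = i then p $ j else 1)"
    by (intro prod.cong) (auto simp: lookup_single when_def)
  then show ?thesis by (simp add: var_eq eval_single)
qed

lemma eval_linear_form [simp]: "eval (linear_form a) p = (\<Sum>i\<in>UNIV. a $ i * p $ i)"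
  by (simp add: linear_form_def)

lemma mem_forms_iff: "f \<in> forms t \<longleftrightarrow> (\<forall>m. lookup f m \<noteq> 0 \<longrightarrow> int (total_degree m) = t)"
  by (auto simp: forms_def in_keys_iff total_degree_def)

lemma mem_forms_nat_iff: "f \<in> forms (int n) \<longleftrightarrow> (\<forall>m. lookup f m \<noteq> 0 \<longrightarrow> total_degree m = n)"
  by (simp add: mem_forms_iff)

lemma subspace_forms: "polys.subspace (forms t)"
  unfolding polys.subspace_def by (auto simp: mem_forms_iff lookup_add) (metis add.right_neutral)

lemmas forms_zero [simp] = polys.subspace_0[OF subspace_forms]
lemmas forms_diff = polys.subspace_diff[OF subspace_forms]
lemmas forms_scale = polys.subspace_scale[OF subspace_forms]
lemmas forms_sum = polys.subspace_sum[OF subspace_forms]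

lemma forms_negative: "t < 0 \<Longrightarrow> f \<in> forms t \<Longrightarrow> f = 0"
  by (rule poly_mapping_eqI) (metis lookup_zero mem_forms_iff of_nat_0_le_iff not_less)

lemma forms_single: "single m c \<in> forms (int (total_degree m))"
  by (auto simp: mem_forms_iff lookup_single when_def)

lemma lookup_times_nonzeroE:
  assumes "lookup (f * g) m \<noteq> 0"
  obtains a b where "m = a + b" "lookup f a \<noteq> 0" "lookup g b \<noteq> 0"
  using keys_mult[of f g] assms by (auto simp: in_keys_iff subset_iff)

lemma forms_times:
  assumes "f \<in> forms s" "g \<in> forms t"
  shows "f * g \<in> forms (s + t)"
  unfolding mem_forms_iff
proof (intro allI impI)
  fix m assume "lookup (f * g) m \<noteq> 0"
  then obtain a b where "m = a + b" "lookup f a \<noteq> 0" "lookup g b \<noteq> 0"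
    by (rule lookup_times_nonzeroE)
  then show "int (total_degree m) = s + t"
    using assms by (auto simp: mem_forms_iff total_degree_add)
qed

lemma forms_const: "const c \<in> forms 0"
  using forms_single[of 0 c] by (simp add: const_def)

lemma forms_one: "1 \<in> forms 0"
  using forms_const[of 1] by (simp add: const_def)

lemma forms_power: "f \<in> forms s \<Longrightarrow> f ^ n \<in> forms (int n * s)"
  by (induction n) (auto simp: forms_one algebra_simps dest: forms_times)

lemma forms_power_linear: "f \<in> forms 1 \<Longrightarrow> f ^ n \<in> forms (int n)"
  using forms_power[of f 1 n] by simp

lemma forms_prod_linear: "(\<And>i. i \<in> A \<Longrightarrow> f i \<in> forms 1) \<Longrightarrow> prod f A \<in> forms (int (card A))"
proof (induction A rule: infinite_finite_induct)
  case (insert x A)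
  then show ?case using forms_times[of "f x" 1 "prod f A" "int (card A)"] by (auto simp: add.commute)
qed (auto simp: forms_one)

lemma forms_var: "var i \<in> forms 1"
  using forms_single[of "exponent i" 1] by (simp add: var_eq)

lemma forms_linear_form: "linear_form a \<in> forms 1"
  unfolding linear_form_def by (intro forms_sum forms_scale forms_var)

lemma eval_forms_scaled:
  assumes "f \<in> forms (int n)"
  shows "eval f (c *s p) = c ^ n * eval f p"
proof -
  have "eval f (c *s p) = (\<Sum>m\<in>keys f. c ^ n * (lookup f m * (\<Prod>i\<in>UNIV. (p $ i) ^ lookup m i)))"
    unfolding eval_def
  proof (intro sum.cong refl)
    fix m assume "m \<in> keys f"
    then have "total_degree m = n" using assms by (auto simp: mem_forms_nat_iff in_keys_iff)
    then show "lookup f m * (\<Prod>i\<in>UNIV. ((c *s p) $ i) ^ lookup m i)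
      = c ^ n * (lookup f m * (\<Prod>i\<in>UNIV. (p $ i) ^ lookup m i))"
      by (simp add: power_mult_distrib prod.distrib power_sum[symmetric] total_degree_def)
  qed
  then show ?thesis by (simp add: eval_def sum_distrib_left)
qed

lemma total_degree_1E:
  assumes "total_degree m = 1"
  obtains i where "m = exponent i"
proof -
  from assms obtain i where i: "lookup m i > 0"
    by (metis total_degree_def sum.neutral gr0I zero_neq_one)
  have "total_degree (m - exponent i) = 0"
    using assms exponent_remove[OF i] total_degree_add[of "m - exponent i" "exponent i"] by simp
  then have "m - exponent i = 0" by (simp only: total_degree_eq_0_iff)
  then show ?thesis using that exponent_remove[OF i] by (metis add.left_neutral)
qed

lemma lookup_linear_form_exponent: "lookup (linear_form a) (exponent i) = a $ i"
proof -
  have "a $ j * (if j = i then 1 else 0) = (if j = i then a $ j else 0)" for j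
    by simp
  then show ?thesis
    by (simp add: linear_form_def lookup_sum var_eq lookup_single when_def del: mult_if_delta)
qed

lemma linear_form_dual_point:
  assumes "l \<in> forms 1"
  shows "linear_form (dual_point l) = l"
proof (rule poly_mapping_eqI)
  fix m
  show "lookup (linear_form (dual_point l)) m = lookup l m"
  proof (cases "total_degree m = 1")
    case True
    then show ?thesis
      by (elim total_degree_1E) (simp add: lookup_linear_form_exponent dual_point_nth)
  next
    case False
    then show ?thesis using assms forms_linear_form[of "dual_point l"]
      by (metis mem_forms_iff of_nat_eq_1_iff)
  qed
qed

lemma linear_form_eq_0_iff: "linear_form a = 0 \<longleftrightarrow> a = 0"
proof
  assume "linear_form a = 0"
  then show "a = 0" using lookup_linear_form_exponent[of a] by (auto simp: vec_eq_iff)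
qed (simp add: linear_form_def)

section \<open>Partial derivatives\<close>

definition pd :: "3 \<Rightarrow> 'k::field ternary \<Rightarrow> 'k ternary" where
  "pd i f = Abs_poly_mapping (\<lambda>m. of_nat (lookup m i + 1) * lookup f (m + exponent i))"

lemma lookup_pd: "lookup (pd i f) m = of_nat (lookup m i + 1) * lookup f (m + exponent i)"
proof -
  have "{m. of_nat (lookup m i + 1) * lookup f (m + exponent i) \<noteq> 0}
      \<subseteq> (\<lambda>m. m - exponent i) ` keys f"
    by (force simp: in_keys_iff image_iff)
  then have "finite {m. of_nat (lookup m i + 1) * lookup f (m + exponent i) \<noteq> 0}"
    by (rule finite_subset) simp
  then show ?thesis by (simp add: pd_def)
qed

lemma pd_add [simp]: "pd i (f + g) = pd i f + pd i g"
  by (rule poly_mapping_eqI) (simp add: lookup_pd lookup_add algebra_simps)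

lemma pd_zero [simp]: "pd i 0 = 0"
  by (rule poly_mapping_eqI) (simp add: lookup_pd)

lemma pd_scale [simp]: "pd i (scale c f) = scale c (pd i f)"
  by (rule poly_mapping_eqI) (simp add: lookup_pd)

lemma pd_sum [simp]: "pd i (sum f A) = (\<Sum>j\<in>A. pd i (f j))"
  by (induction A rule: infinite_finite_induct) auto

text \<open>Subtraction of exponents is truncated, so \<open>m - exponent i\<close> is wrong when
  the variable does not occur in \<open>m\<close>; the factor \<open>lookup m i\<close> is then 0
  and removes the term.\<close>

lemma pd_single: "pd i (single m c) = single (m - exponent i) (of_nat (lookup m i) * c)"
proof (rule poly_mapping_eqI)
  fix n
  show "lookup (pd i (single m c)) n = lookup (single (m - exponent i) (of_nat (lookup m i) * c)) n"
  proof (cases "lookup m i = 0")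
    case True
    then have "m \<noteq> n + exponent i" by (auto simp: lookup_add)
    then show ?thesis using True by (simp add: lookup_pd lookup_single)
  next
    case False
    then have "m - exponent i = n \<longleftrightarrow> m = n + exponent i"
      using exponent_remove[of m i] by auto
    then show ?thesis by (auto simp: lookup_pd lookup_single lookup_add when_def)
  qed
qed

lemma pd_times: "pd i (f * g) = pd i f * g + f * pd i g"
proof (induction f rule: poly_mapping_single_induct)
  case (single m c)
  show ?case
  proof (induction g rule: poly_mapping_single_induct)
    case (single n e)
    have 1: "m + n - exponent i = m - exponent i + n" if "lookup m i > 0"
      by (rule poly_mapping_eqI) (use that in \<open>auto simp: lookup_minus lookup_add lookup_single when_def\<close>)
    have 2: "m + n - exponent i = m + (n - exponent i)" if "lookup n i > 0"
      by (rule poly_mapping_eqI) (use that in \<open>auto simp: lookup_minus lookup_add lookup_single when_def\<close>)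
    \<comment> \<open>If the variable is absent from the factor, the exponents may differ, but both
      coefficients are 0.\<close>
    have a: "single (m - exponent i + n) (of_nat (lookup m i) * (c * e)) =
        single (m + n - exponent i) (of_nat (lookup m i) * (c * e))"
      using 1 by (cases "lookup m i") auto
    have b: "single (m + (n - exponent i)) (of_nat (lookup n i) * (c * e)) =
        single (m + n - exponent i) (of_nat (lookup n i) * (c * e))"
      using 2 by (cases "lookup n i") auto
    show ?case
      by (simp only: mult_single pd_single)
        (use a b in \<open>simp add: lookup_add single_add[symmetric] algebra_simps\<close>)
  qed (simp add: algebra_simps)
qed (simp add: algebra_simps)

lemma pd_commute: "pd i (pd j f) = pd j (pd i f)"
  by (rule poly_mapping_eqI)
    (cases "i = j"; simp add: lookup_pd lookup_add lookup_single add_ac)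

lemma forms_pd: "f \<in> forms t \<Longrightarrow> pd i f \<in> forms (t - 1)"
  by (auto simp: mem_forms_iff lookup_pd total_degree_add)

text \<open>The operator \<open>x_i d/dx_i\<close> is diagonal on monomials, with the exponent of
  \<open>x_i\<close> as eigenvalue. Summing the eigenvalues over \<open>i\<close> gives the degree,
  which is Euler's identity.\<close>

lemma lookup_var_times_pd: "lookup (var i * pd i f) m = of_nat (lookup m i) * lookup f m"
proof (induction f rule: poly_mapping_single_induct)
  case (single n c)
  have "var i * pd i (single n c) = single n (of_nat (lookup n i) * c)"
    using exponent_remove[of n i]
    by (cases "lookup n i") (simp_all add: var_eq pd_single mult_single add.commute)
  then show ?case by (simp add: lookup_single when_def)
qed (simp add: lookup_add algebra_simps)

lemma euler_identity:
  assumes "f \<in> forms (int n)"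
  shows "(\<Sum>i\<in>UNIV. var i * pd i f) = scale (of_nat n) f"
proof (rule poly_mapping_eqI)
  fix m
  have "(\<Sum>i\<in>UNIV. of_nat (lookup m i) * lookup f m) = of_nat (total_degree m) * lookup f m"
    by (simp add: total_degree_def sum_distrib_right)
  then show "lookup (\<Sum>i\<in>UNIV. var i * pd i f) m = lookup (scale (of_nat n) f) m"
    using assms by (auto simp: lookup_sum lookup_var_times_pd mem_forms_nat_iff)
qed

definition dir_deriv :: "'k::field ^ 3 \<Rightarrow> 'k ternary \<Rightarrow> 'k ternary" where
  "dir_deriv a f = (\<Sum>i\<in>UNIV. scale (a $ i) (pd i f))"

lemma dir_deriv_pd: "dir_deriv a (pd i f) = pd i (dir_deriv a f)"
  by (simp add: dir_deriv_def pd_commute[of i])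

lemma dir_deriv_funpow_pd: "(dir_deriv a ^^ n) (pd i f) = pd i ((dir_deriv a ^^ n) f)"
  by (induction n) (auto simp: dir_deriv_pd)

lemma forms_dir_deriv: "f \<in> forms t \<Longrightarrow> dir_deriv a f \<in> forms (t - 1)"
  unfolding dir_deriv_def by (intro forms_sum forms_scale forms_pd)

lemma forms_dir_deriv_funpow: "f \<in> forms t \<Longrightarrow> (dir_deriv a ^^ n) f \<in> forms (t - int n)"
proof (induction n arbitrary: f t)
  case (Suc n)
  show ?case using Suc.IH[OF forms_dir_deriv[OF Suc.prems]]
    by (simp add: funpow_swap1 algebra_simps)
qed simp

lemma eval_dir_deriv_same:
  assumes "f \<in> forms (int n)"
  shows "eval (dir_deriv a f) a = of_nat n * eval f a"
  using arg_cong[OF euler_identity[OF assms], of "\<lambda>g. eval g a"]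
  by (simp add: dir_deriv_def)

lemma forms_0_const: "f \<in> forms 0 \<Longrightarrow> f = const (lookup f 0)"
proof (rule poly_mapping_eqI)
  fix m assume "f \<in> forms 0"
  then show "lookup f m = lookup (const (lookup f 0)) m"
    by (auto simp: mem_forms_iff const_def lookup_single when_def total_degree_eq_0_iff)
qed

text \<open>By Euler's identity at \<open>a\<close>, each derivation in direction \<open>a\<close>
  multiplies the value at \<open>a\<close> by the current degree, and the degrees from
  \<open>n\<close> down to 1 multiply to \<open>fact n\<close>. In degree 0 the form equals its
  value.\<close>

lemma dir_deriv_funpow_full:
  "f \<in> forms (int n) \<Longrightarrow> (dir_deriv a ^^ n) f = const (fact n * eval f a)"
proof (induction n arbitrary: f)
  case 0
  then show ?case using forms_0_const[of f] eval_const by (metis fact_0 funpow_0 int_ops(1) mult_1)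
next
  case (Suc n)
  have "dir_deriv a f \<in> forms (int n)" using forms_dir_deriv[OF Suc.prems] by simp
  from Suc.IH[OF this] show ?case
    by (simp add: funpow_swap1 eval_dir_deriv_same[OF Suc.prems] algebra_simps)
qed

section \<open>The apolarity pairing\<close>

definition exponent_fact :: "(3 \<Rightarrow>\<^sub>0 nat) \<Rightarrow> 'k::field_char_0" where
  "exponent_fact m = (\<Prod>i\<in>UNIV. fact (lookup m i))"

text \<open>This is the value at 0 of \<open>f(d/dx) g\<close>. The weights
  \<open>exponent_fact\<close> make multiplication by a variable adjoint to the derivative in that
  variable.\<close>

definition pairing :: "'k::field_char_0 ternary \<Rightarrow> 'k ternary \<Rightarrow> 'k" where
  "pairing f g = (\<Sum>m\<in>keys f. lookup f m * lookup g m * exponent_fact m)"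

lemma pairing_superset:
  assumes "finite A" "keys f \<subseteq> A"
  shows "pairing f g = (\<Sum>m\<in>A. lookup f m * lookup g m * exponent_fact m)"
  unfolding pairing_def using assms
  by (intro sum.mono_neutral_left) (auto simp: in_keys_iff)

lemma pairing_add_left: "pairing (f + f') g = pairing f g + pairing f' g"
proof -
  have "finite (keys f \<union> keys f')" by simp
  from pairing_superset[OF this, of f g] pairing_superset[OF this, of f' g]
    pairing_superset[OF this keys_add, of g]
  show ?thesis by (simp add: lookup_add algebra_simps sum.distrib)
qed

lemma pairing_add_right: "pairing f (g + g') = pairing f g + pairing f g'"
  by (simp add: pairing_def lookup_add algebra_simps sum.distrib)

lemma pairing_scale_right: "pairing f (scale c g) = c * pairing f g"
  by (simp add: pairing_def sum_distrib_left mult.left_commute mult.assoc)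

lemma pairing_single: "pairing (single m c) g = c * lookup g m * exponent_fact m"
  by (subst pairing_superset[of "{m}"]) auto

lemma pairing_scale_left: "pairing (scale c f) g = c * pairing f g"
  by (induction f rule: poly_mapping_single_induct)
    (simp_all add: scale_single pairing_single pairing_add_left polys.scale_right_distrib algebra_simps)

lemma pairing_sum_left: "pairing (sum f A) g = (\<Sum>i\<in>A. pairing (f i) g)"
  by (induction A rule: infinite_finite_induct) (auto simp: pairing_add_left, simp_all add: pairing_def)

lemma pairing_sum_right: "pairing f (sum g A) = (\<Sum>i\<in>A. pairing f (g i))"
  by (induction A rule: infinite_finite_induct) (auto simp: pairing_add_right, simp_all add: pairing_def)

lemma exponent_fact_add_exponent:
  "exponent_fact (m + exponent i) = of_nat (lookup m i + 1) * (exponent_fact m :: 'k::field_char_0)"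
proof -
  have "(exponent_fact (m + exponent i) :: 'k)
      = (\<Prod>j\<in>UNIV. (if j = i then of_nat (lookup m i + 1) else 1) * fact (lookup m j))"
    unfolding exponent_fact_def by (intro prod.cong) (auto simp: lookup_add)
  then show ?thesis by (simp add: prod.distrib exponent_fact_def)
qed

text \<open>The factor that \<open>exponent_fact\<close> gains from one more
  \<open>exponent i\<close> is the factor that \<open>pd i\<close> brings down.\<close>

lemma pairing_var_times: "pairing (var i * f) g = pairing f (pd i g)"
  by (induction f rule: poly_mapping_single_induct)
    (simp_all add: var_eq mult_single pairing_single lookup_pd exponent_fact_add_exponent
      distrib_left pairing_add_left add.commute[of "exponent i"] algebra_simps)

lemma pairing_linear_form_times: "pairing (linear_form a * f) g = pairing f (dir_deriv a g)"
  by (simp add: linear_form_def dir_deriv_def sum_distrib_right pairing_sum_left pairing_sum_right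
      pairing_scale_left pairing_scale_right pairing_var_times)

lemma pairing_linear_form_power_times:
  "pairing (linear_form a ^ n * f) g = pairing f ((dir_deriv a ^^ n) g)"
  by (induction n arbitrary: g) (simp_all add: pairing_linear_form_times mult.assoc funpow_swap1)

text \<open>Moving all \<open>n\<close> linear factors to the other side leaves the full directional
  derivative, a multiple of the value at \<open>a\<close>. Orthogonality to the power of a linear
  form thus means vanishing at its dual point.\<close>

lemma pairing_linear_form_power:
  assumes "g \<in> forms (int n)"
  shows "pairing (linear_form a ^ n) g = fact n * eval g a"
proof -
  have "pairing (linear_form a ^ n) g = pairing (single 0 1) (const (fact n * eval g a))"
    using pairing_linear_form_power_times[of a n 1 g] dir_deriv_funpow_full[OF assms, of a] by simp
  then show ?thesis by (simp only: pairing_single const_def) (simp add: exponent_fact_def)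
qed

text \<open>Pairing with a monomial isolates one coefficient of \<open>g\<close>, up to a product of
  factorials, which is nonzero in characteristic 0.\<close>

lemma pairing_nondegenerate:
  fixes g :: "'k::field_char_0 ternary"
  assumes "g \<in> forms t" and "\<And>f. f \<in> forms t \<Longrightarrow> pairing f g = 0"
  shows "g = 0"
proof (rule poly_mapping_eqI)
  fix m
  show "lookup g m = lookup 0 m"
  proof (rule ccontr)
    assume *: "lookup g m \<noteq> lookup 0 m"
    then have "int (total_degree m) = t" using assms(1) by (auto simp: mem_forms_iff)
    then have "pairing (single m 1) g = 0" using assms(2) forms_single by blast
    moreover have "(exponent_fact m :: 'k) \<noteq> 0" by (simp add: exponent_fact_def)
    ultimately show False using * by (simp add: pairing_single)
  qed
qed

section \<open>Dimensions in finitely spanned vector spaces\<close>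

context vector_space
begin

text \<open>The polynomial ring is infinite-dimensional, so finiteness is supplied by a finite set
  \<open>F\<close> whose span contains the subspaces in question; for forms this will be the set of
  monomials of the degree.\<close>

lemma finite_basis_exists:
  assumes "V \<subseteq> span F" "finite F"
  shows "\<exists>B. B \<subseteq> V \<and> independent B \<and> V \<subseteq> span B \<and> card B = dim V \<and> finite B"
proof -
  obtain B where B: "B \<subseteq> V" "independent B" "V \<subseteq> span B" "card B = dim V"
    by (rule basis_exists)
  have "B \<subseteq> span F" using B(1) assms(1) by (rule subset_trans)
  then have "finite B" using independent_span_bound[OF assms(2) B(2)] by simp
  with B show ?thesis by (intro exI[of _ B]) simp
qed

lemma finite_basis_extend:
  assumes "V \<subseteq> span F" "finite F" "A \<subseteq> V" "independent A"
  shows "\<exists>B. A \<subseteq> B \<and> B \<subseteq> V \<and> independent B \<and> V \<subseteq> span B \<and> card B = dim V \<and> finite B"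
proof -
  obtain B where B: "A \<subseteq> B" "B \<subseteq> V" "independent B" "V \<subseteq> span B"
    by (rule maximal_independent_subset_extend[OF assms(3,4)])
  have "B \<subseteq> span F" using B(2) assms(1) by (rule subset_trans)
  then have "finite B" using independent_span_bound[OF assms(2) B(3)] by simp
  with B basis_card_eq_dim[OF B(2,4,3)] show ?thesis by (intro exI[of _ B]) simp
qed

lemma dim_mono_finite_span:
  assumes "U \<subseteq> span V" "V \<subseteq> span F" "finite F"
  shows "dim U \<le> dim V"
proof -
  obtain B where B: "V \<subseteq> span B" "card B = dim V" "finite B"
    using finite_basis_exists[OF assms(2,3)] by blast
  then have "U \<subseteq> span B" using assms(1) span_minimal[OF B(1) subspace_span] by blast
  then show ?thesis using dim_le_card[OF _ B(3)] B(2) by simp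
qed

lemma card_le_dim_finite_span:
  assumes "B \<subseteq> V" "independent B" "V \<subseteq> span F" "finite F"
  shows "card B \<le> dim V"
  using dim_mono_finite_span[OF subset_trans[OF assms(1) span_superset] assms(3,4)]
  by (simp add: dim_eq_card_independent[OF assms(2)])

lemma dim_eq_imp_span_eq:
  assumes "U \<subseteq> V" "dim U = dim V" "V \<subseteq> span F" "finite F"
  shows "V \<subseteq> span U"
proof -
  obtain B where B: "B \<subseteq> U" "independent B" "card B = dim U" "finite B"
    using finite_basis_exists[OF subset_trans[OF assms(1,3)] assms(4)] by blast
  obtain C where C: "B \<subseteq> C" "V \<subseteq> span C" "card C = dim V" "finite C"
    using finite_basis_extend[OF assms(3,4) subset_trans[OF B(1) assms(1)] B(2)] by blast
  have "B = C" using card_subset_eq[OF C(4,1)] B(3) C(3) assms(2) by simp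
  then show ?thesis using C(2) span_mono[OF B(1)] by blast
qed

text \<open>If the functional is nonzero at some \<open>w\<close> in \<open>U\<close>, subtracting a
  multiple of \<open>w\<close> moves any vector of \<open>U\<close> into the kernel, so the kernel
  and \<open>w\<close> span \<open>U\<close>.\<close>

lemma dim_le_dim_zeros:
  assumes U: "subspace U" "U \<subseteq> span F" "finite F"
    and \<phi>: "\<And>x y. \<phi> (x + y) = \<phi> x + \<phi> y" "\<And>c x. \<phi> (scale c x) = c * \<phi> x"
  shows "dim U \<le> dim {u \<in> U. \<phi> u = 0} + 1"
proof (cases "\<forall>u\<in>U. \<phi> u = 0")
  case True
  then have "{u \<in> U. \<phi> u = 0} = U" by auto
  then show ?thesis by simp
next
  case False
  then obtain w where w: "w \<in> U" "\<phi> w \<noteq> 0" by auto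
  let ?K = "{u \<in> U. \<phi> u = 0}"
  have K: "?K \<subseteq> span F" using U by auto
  obtain B where B: "?K \<subseteq> span B" "card B = dim ?K" "finite B"
    using finite_basis_exists[OF K U(3)] by blast
  have "U \<subseteq> span (insert w B)"
  proof
    fix u assume u: "u \<in> U"
    define c where "c = \<phi> u / \<phi> w"
    have "\<phi> (u + scale (- c) w) = 0" using w unfolding \<phi> by (simp add: c_def)
    then have "u + scale (- c) w \<in> ?K"
      using subspace_add[OF U(1) u subspace_scale[OF U(1) w(1)]] by blast
    then have "u - scale c w \<in> span B" using B(1) by auto
    then show "u \<in> span (insert w B)" by (auto simp: span_insert)
  qed
  then have "dim U \<le> card (insert w B)" using B(3) by (intro dim_le_card) auto
  also have "\<dots> \<le> card B + 1" by (simp add: card_insert_if B(3))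
  finally show ?thesis using B(2) by simp
qed

lemma dim_le_dim_common_zeros:
  assumes "finite C" "subspace U" "U \<subseteq> span F" "finite F"
    and \<phi>: "\<And>c x y. \<phi> c (x + y) = \<phi> c x + \<phi> c y" "\<And>c a x. \<phi> c (scale a x) = a * \<phi> c x"
  shows "dim U \<le> dim {u \<in> U. \<forall>c\<in>C. \<phi> c u = 0} + card C"
  using assms(1)
proof (induction C)
  case (insert c C)
  let ?U = "{u \<in> U. \<forall>c\<in>C. \<phi> c u = 0}"
  have "\<phi> e 0 = 0" for e using \<phi>(2)[of e 0 0] by simp
  then have "subspace ?U" using assms(2) by (auto simp: subspace_def \<phi>)
  moreover have "?U \<subseteq> span F" using assms(3) by auto
  ultimately have "dim ?U \<le> dim {u \<in> ?U. \<phi> c u = 0} + 1"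
    using dim_le_dim_zeros[of ?U F "\<phi> c"] assms(4) \<phi> by simp
  moreover have "{u \<in> ?U. \<phi> c u = 0} = {u \<in> U. \<forall>c\<in>insert c C. \<phi> c u = 0}" by auto
  ultimately show ?case using insert by simp
qed simp

text \<open>Adding one vector to \<open>W\<close> lowers the dimension of the orthogonal space by at most 1.
  On the way from \<open>{}\<close> to \<open>V\<close> it drops from \<open>dim V\<close> to 0 in \<open>dim V\<close> steps, so every step
  lowers it by exactly 1.\<close>

lemma dim_orthogonal:
  assumes V: "subspace V" "V \<subseteq> span F" "finite F" and W: "W \<subseteq> V"
    and right: "\<And>w x y. \<beta> w (x + y) = \<beta> w x + \<beta> w y" "\<And>w a x. \<beta> w (scale a x) = a * \<beta> w x"
    and left: "\<And>w x y. \<beta> (x + y) w = \<beta> x w + \<beta> y w" "\<And>w a x. \<beta> (scale a x) w = a * \<beta> x w"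
    and nondeg: "\<And>v. v \<in> V \<Longrightarrow> (\<forall>w\<in>V. \<beta> w v = 0) \<Longrightarrow> v = 0"
  shows "dim {v \<in> V. \<forall>w\<in>W. \<beta> w v = 0} + dim W = dim V"
proof -
  have on_span: "\<beta> w v = 0" if "\<forall>b\<in>B. \<beta> b v = 0" "w \<in> span B" for B v w
  proof -
    have "\<beta> 0 v = 0" using left(2)[of 0 0 v] by simp
    then have "subspace {w. \<beta> w v = 0}" by (auto simp: subspace_def left)
    moreover have "B \<subseteq> {w. \<beta> w v = 0}" using that by auto
    ultimately show ?thesis using that(2) span_minimal by blast
  qed
  obtain B where B: "B \<subseteq> W" "independent B" "W \<subseteq> span B" "card B = dim W" "finite B"
    using finite_basis_exists[OF subset_trans[OF W V(2)] V(3)] by blast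
  obtain C where C: "B \<subseteq> C" "C \<subseteq> V" "V \<subseteq> span C" "card C = dim V" "finite C"
    using finite_basis_extend[OF V(2,3) subset_trans[OF B(1) W] B(2)] by blast
  let ?P = "{v \<in> V. \<forall>w\<in>W. \<beta> w v = 0}"
  have P: "?P = {v \<in> V. \<forall>w\<in>B. \<beta> w v = 0}" using on_span B by blast
  have "dim V \<le> dim ?P + card B"
    unfolding P by (rule dim_le_dim_common_zeros[OF B(5) V]) (rule right)+
  moreover have "dim ?P \<le> dim {v \<in> ?P. \<forall>w\<in>C - B. \<beta> w v = 0} + card (C - B)"
  proof (rule dim_le_dim_common_zeros[OF _ _ _ V(3)])
    have "\<beta> w 0 = 0" for w using right(2)[of w 0 0] by simp
    then show "subspace ?P" using V(1) by (auto simp: subspace_def right)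
  qed (use V C right in auto)
  moreover have "{v \<in> ?P. \<forall>w\<in>C - B. \<beta> w v = 0} \<subseteq> {0}"
    unfolding P using nondeg on_span[of C] C(3) by blast
  then have "dim {v \<in> ?P. \<forall>w\<in>C - B. \<beta> w v = 0} \<le> 0"
    using dim_le_card[of _ "{}"] by auto
  moreover have "card (C - B) + card B = card C"
    using C B by (metis card_Diff_subset card_mono le_add_diff_inverse2)
  ultimately show ?thesis using B C by linarith
qed

lemma Un_subset_span_Un:
  assumes "S \<subseteq> span B" "T \<subseteq> span C"
  shows "S \<union> T \<subseteq> span (B \<union> C)"
  using assms span_mono[of B "B \<union> C"] span_mono[of C "B \<union> C"] by blast

lemma dim_Un_le:
  assumes "S \<subseteq> span F" "T \<subseteq> span F" "finite F"
  shows "dim (S \<union> T) \<le> dim S + dim T"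
proof -
  obtain B where B: "S \<subseteq> span B" "card B = dim S" "finite B"
    using finite_basis_exists[OF assms(1,3)] by blast
  obtain C where C: "T \<subseteq> span C" "card C = dim T" "finite C"
    using finite_basis_exists[OF assms(2,3)] by blast
  have "S \<union> T \<subseteq> span (B \<union> C)" using B(1) C(1) by (rule Un_subset_span_Un)
  then have "dim (S \<union> T) \<le> card (B \<union> C)" using B C by (intro dim_le_card) auto
  then show ?thesis using card_Un_le[of B C] B C by linarith
qed

text \<open>The dimension of the union is that of the sum of the two subspaces, so the equation says
  that the sum is direct. Applied to the degree piece of the ideal and the image of a
  multiplication, it will express injectivity.\<close>

lemma dim_Un_eq_iff:
  assumes S: "subspace S" "S \<subseteq> span F" and T: "subspace T" "T \<subseteq> span F" and F: "finite F"
  shows "dim (S \<union> T) = dim S + dim T \<longleftrightarrow> S \<inter> T \<subseteq> {0}"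
proof
  assume *: "S \<inter> T \<subseteq> {0}"
  obtain B where B: "B \<subseteq> S" "independent B" "S \<subseteq> span B" "card B = dim S" "finite B"
    using finite_basis_exists[OF S(2) F] by blast
  obtain C where C: "C \<subseteq> T" "independent C" "T \<subseteq> span C" "card C = dim T" "finite C"
    using finite_basis_exists[OF T(2) F] by blast
  have "0 \<notin> B" using B(2) dependent_zero by blast
  then have disj: "B \<inter> C = {}" using * B(1) C(1) by auto
  have "independent (B \<union> C)"
  proof (rule independent_if_scalars_zero)
    fix u x assume sum: "(\<Sum>x\<in>B \<union> C. scale (u x) x) = 0" and x: "x \<in> B \<union> C"
    let ?s = "\<Sum>x\<in>B. scale (u x) x" and ?t = "\<Sum>x\<in>C. scale (u x) x"
    have st: "?s + ?t = 0" using sum disj B(5) C(5) by (simp add: sum.union_disjoint)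
    have s: "?s \<in> S" and t: "?t \<in> T"
      using B(1) C(1) S(1) T(1) by (auto intro!: subspace_sum subspace_scale)
    have "?s = - ?t" using st by (simp add: eq_neg_iff_add_eq_0)
    then have "?s \<in> T" using t T(1) subspace_neg by simp
    with s * have "?s = 0" by auto
    moreover from this st have "?t = 0" by simp
    ultimately show "u x = 0"
      using x independentD[OF B(2) B(5)] independentD[OF C(2) C(5)] by blast
  qed (use B C in auto)
  moreover have "S \<union> T \<subseteq> span (B \<union> C)"
    using B(3) C(3) by (rule Un_subset_span_Un)
  ultimately have "card (B \<union> C) = dim (S \<union> T)"
    using B(1) C(1) by (intro basis_card_eq_dim) auto
  then show "dim (S \<union> T) = dim S + dim T"
    using disj B C by (simp add: card_Un_disjoint)
next
  assume *: "dim (S \<union> T) = dim S + dim T"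
  show "S \<inter> T \<subseteq> {0}"
  proof (rule ccontr)
    assume "\<not> S \<inter> T \<subseteq> {0}"
    then obtain x where x: "x \<in> S" "x \<in> T" "x \<noteq> 0" by auto
    \<comment> \<open>The common vector \<open>x\<close> is put into a basis of each subspace; the
      union of the two bases, which spans the sum, then has fewer than \<open>dim S + dim T\<close>
      elements.\<close>
    then have ind: "independent {x}" by simp
    obtain B where B: "{x} \<subseteq> B" "S \<subseteq> span B" "card B = dim S" "finite B"
      using finite_basis_extend[OF S(2) F _ ind] x by blast
    obtain C where C: "{x} \<subseteq> C" "T \<subseteq> span C" "card C = dim T" "finite C"
      using finite_basis_extend[OF T(2) F _ ind] x by blast
    have "S \<union> T \<subseteq> span (B \<union> C)"
      using B(2) C(2) by (rule Un_subset_span_Un)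
    then have "dim (S \<union> T) \<le> card (B \<union> C)" using B C by (intro dim_le_card) auto
    moreover have "card (B \<union> C) + card (B \<inter> C) = card B + card C"
      using card_Un_Int[OF B(4) C(4)] by simp
    moreover have "card (B \<inter> C) > 0" using B C by (auto simp: card_gt_0_iff)
    ultimately show False using * B C by linarith
  qed
qed

end

section \<open>Dimensions of spaces of forms\<close>

lemma single_one_eq_iff: "single m (1::'k::zero_neq_one) = single n 1 \<longleftrightarrow> m = n"
proof
  assume "single m (1::'k) = single n 1"
  then have "lookup (single m (1::'k)) m = lookup (single n 1) m" by simp
  then show "m = n" by (simp add: lookup_single when_def split: if_splits)
qed simp

definition monomials :: "nat \<Rightarrow> 'k::field ternary set" where
  "monomials n = (\<lambda>m. single m 1) ` {m. total_degree m = n}"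

text \<open>Exponents correspond to lists of three natural numbers with sum \<open>n\<close>, which
  stars and bars counts.\<close>

lemma finite_total_degree: "finite {m. total_degree m = n}"
  and card_total_degree: "card {m. total_degree m = n} = (n + 2) choose 2"
proof -
  let ?L = "{xs::nat list. length xs = 3 \<and> sum_list xs = n}"
  let ?h = "\<lambda>m::3 \<Rightarrow>\<^sub>0 nat. [lookup m 1, lookup m 2, lookup m 3]"
  have td: "total_degree m = lookup m 1 + lookup m 2 + lookup m 3" for m
    by (simp only: total_degree_def sum_3)
  have bij: "bij_betw ?h {m. total_degree m = n} ?L"
  proof (rule bij_betwI')
    fix x y :: "3 \<Rightarrow>\<^sub>0 nat"
    show "(?h x = ?h y) = (x = y)"
    proof
      assume "?h x = ?h y"
      then have "lookup x i = lookup y i" for i using exhaust_3[of i] by auto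
      then show "x = y" by (rule poly_mapping_eqI)
    qed simp
  next
    fix x :: "3 \<Rightarrow>\<^sub>0 nat" assume "x \<in> {m. total_degree m = n}"
    then show "?h x \<in> ?L" by (simp add: td)
  next
    fix xs assume "xs \<in> ?L"
    then obtain a b c where xs: "xs = [a, b, c]" "a + b + c = n"
      by (auto simp: numeral_3_eq_3 length_Suc_conv add.assoc)
    let ?m = "Abs_poly_mapping (\<lambda>i::3. if i = 1 then a else if i = 2 then b else c)"
    have l: "lookup ?m = (\<lambda>i::3. if i = 1 then a else if i = 2 then b else c)"
      by (rule lookup_Abs_poly_mapping) simp
    have "xs = ?h ?m" "?m \<in> {m. total_degree m = n}"
      unfolding mem_Collect_eq td l using xs by auto
    then show "\<exists>x\<in>{m. total_degree m = n}. xs = ?h x" by blast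
  qed
  have card: "card ?L = (n + 2) choose 2"
    using card_length_sum_list[of 3 n] binomial_symmetric[of n "n + 2"] by simp
  \<comment> \<open>Infinite sets have cardinality 0 by convention, so a positive count implies
    finiteness.\<close>
  have "(n + 2) choose 2 > 0" by (intro zero_less_binomial) simp
  then have "finite ?L" unfolding card[symmetric] by (rule card_ge_0_finite)
  with bij_betw_finite[OF bij] show "finite {m. total_degree m = n}" by simp
  from bij_betw_same_card[OF bij] card show "card {m. total_degree m = n} = (n + 2) choose 2"
    by (rule trans)
qed

lemma finite_monomials: "finite (monomials n)"
  by (simp add: monomials_def finite_total_degree)

lemma monomials_subset_forms: "monomials n \<subseteq> forms (int n)"
  by (auto simp: monomials_def forms_single)

lemma forms_subset_span_monomials: "forms (int n) \<subseteq> polys.span (monomials n :: 'k::field ternary set)"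
proof
  fix f :: "'k ternary" assume f: "f \<in> forms (int n)"
  have "(\<Sum>m\<in>keys f. single m (lookup f m)) \<in> polys.span (monomials n)"
  proof (rule polys.span_sum)
    fix m assume "m \<in> keys f"
    then have "single m 1 \<in> monomials n"
      using f by (auto simp: monomials_def mem_forms_nat_iff in_keys_iff)
    from polys.span_scale[OF polys.span_base[OF this], of "lookup f m"]
    show "single m (lookup f m) \<in> polys.span (monomials n)" by (simp add: scale_single)
  qed
  then show "f \<in> polys.span (monomials n)" unfolding poly_mapping_sum_single[of f, symmetric] .
qed

lemma span_monomials: "polys.span (monomials n) = forms (int n)"
  using forms_subset_span_monomials polys.span_minimal[OF monomials_subset_forms subspace_forms] by blast

lemma independent_monomials: "polys.independent (monomials n :: 'k::field ternary set)"
proof (rule polys.independent_if_scalars_zero)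
  fix u :: "'k ternary \<Rightarrow> 'k" and x :: "'k ternary"
  assume *: "(\<Sum>x\<in>monomials n. scale (u x) x) = 0" and "x \<in> monomials n"
  then obtain m where m: "x = single m 1" "total_degree m = n" by (auto simp: monomials_def)
  have inj: "inj_on (\<lambda>m. single m (1::'k)) {m. total_degree m = n}"
    by (rule inj_onI) (simp add: single_one_eq_iff)
  have "0 = lookup (\<Sum>x\<in>monomials n. scale (u x) x) m" using * by simp
  also have "\<dots> = (\<Sum>k\<in>{m. total_degree m = n}. u (single k 1) * lookup (single k 1) m)"
    unfolding monomials_def lookup_sum lookup_scale by (rule sum.reindex[OF inj, unfolded o_def])
  also have "\<dots> = (\<Sum>k\<in>{m. total_degree m = n}. if k = m then u (single k 1) else 0)"
    by (intro sum.cong) (auto simp: lookup_single)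
  also have "\<dots> = u x" using m finite_total_degree[of n] by simp
  finally show "u x = 0" by simp
qed (rule finite_monomials)

lemma dim_forms: "polys.dim (forms (int n) :: 'k::field ternary set) = (n + 2) choose 2"
proof -
  have inj: "inj_on (\<lambda>m. single m (1::'k)) {m. total_degree m = n}"
    by (rule inj_onI) (simp add: single_one_eq_iff)
  have "polys.dim (forms (int n) :: 'k ternary set) = card (monomials n :: 'k ternary set)"
    using polys.dim_span_eq_card_independent[OF independent_monomials, of n]
    by (simp only: span_monomials)
  then show ?thesis unfolding monomials_def card_image[OF inj] card_total_degree .
qed

lemma dim_times_image:
  fixes f :: "'k::field ternary"
  assumes "f \<noteq> 0" "polys.subspace U" "U \<subseteq> polys.span F" "finite F"
  shows "polys.dim ((*) f ` U) = polys.dim U"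
proof -
  obtain B where B: "B \<subseteq> U" "polys.independent B" "U \<subseteq> polys.span B" "card B = polys.dim U" "finite B"
    using polys.finite_basis_exists[OF assms(3,4)] by blast
  have inj: "inj_on ((*) f) B" using assms(1) by (auto simp: inj_on_def)
  have "polys.independent ((*) f ` B)"
  proof (rule polys.independent_if_scalars_zero)
    fix u x assume *: "(\<Sum>x\<in>(*) f ` B. scale (u x) x) = 0" and x: "x \<in> (*) f ` B"
    then obtain b where b: "x = f * b" "b \<in> B" by auto
    have "(\<Sum>x\<in>(*) f ` B. scale (u x) x) = f * (\<Sum>b\<in>B. scale (u (f * b)) b)"
      by (simp add: sum.reindex[OF inj] sum_distrib_left)
    then have "(\<Sum>b\<in>B. scale (u (f * b)) b) = 0" using * assms(1) by auto
    then show "u x = 0" using polys.independentD[OF B(2,5) subset_refl, of "\<lambda>b. u (f * b)" b] b by simp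
  qed (use B in auto)
  moreover have "(*) f ` U \<subseteq> polys.span ((*) f ` B)"
  proof
    fix y assume "y \<in> (*) f ` U"
    then obtain g where g: "y = f * g" "g \<in> polys.span B" using B by auto
    have "polys.subspace {g. f * g \<in> polys.span ((*) f ` B)}"
      unfolding polys.subspace_def
      by (auto simp: distrib_left intro: polys.span_zero polys.span_add polys.span_scale)
    moreover have "B \<subseteq> {g. f * g \<in> polys.span ((*) f ` B)}" by (auto intro: polys.span_base)
    ultimately show "y \<in> polys.span ((*) f ` B)" using g polys.span_minimal by blast
  qed
  ultimately have "polys.dim ((*) f ` U) = card ((*) f ` B)"
    using B(1) by (intro polys.dim_unique) auto
  then show ?thesis using B(4) card_image[OF inj] by simp
qed

section \<open>Ideals of points and orders of vanishing\<close>

lemma subspace_ideal_prod: "ideal.subspace (ideal_prod I J)"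
  by (simp add: ideal_prod_def)

lemma subspace_ideal_power: "ideal.subspace (ideal_power I n)"
  by (cases n) (simp_all add: subspace_ideal_prod)

lemma subspace_vanishing_ideal: "ideal.subspace (vanishing_ideal Z)"
  by (simp add: vanishing_ideal_def)

lemma ideal_prod_mem: "f \<in> I \<Longrightarrow> g \<in> J \<Longrightarrow> f * g \<in> ideal_prod I J"
  unfolding ideal_prod_def by (rule ideal.span_base) blast

lemma ideal_power_mem: "f \<in> I \<Longrightarrow> f ^ n \<in> ideal_power I n"
  by (induction n) (auto intro: ideal_prod_mem)

lemma ideal_prod_subset:
  assumes "ideal.subspace K" "\<And>f g. f \<in> I \<Longrightarrow> g \<in> J \<Longrightarrow> f * g \<in> K"
  shows "ideal_prod I J \<subseteq> K"
  unfolding ideal_prod_def by (rule ideal.span_minimal[OF _ assms(1)]) (use assms(2) in auto)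

lemma ideal_prod_subset_right:
  assumes "ideal.subspace J"
  shows "ideal_prod I J \<subseteq> J"
  by (rule ideal_prod_subset[OF assms]) (rule ideal.subspace_scale[OF assms])

lemma ideal_prod_subset_left:
  assumes "ideal.subspace I"
  shows "ideal_prod I J \<subseteq> I"
  by (rule ideal_prod_subset[OF assms]) (metis ideal.subspace_scale[OF assms] mult.commute)

lemma vanishing_ideal_mem: "f \<in> forms t \<Longrightarrow> (\<And>p. p \<in> Z \<Longrightarrow> eval f p = 0) \<Longrightarrow> f \<in> vanishing_ideal Z"
  unfolding vanishing_ideal_def by (rule ideal.span_base) blast

lemma vanishing_ideal_eval:
  assumes "f \<in> vanishing_ideal Z" "p \<in> Z"
  shows "eval f p = 0"
proof -
  have "ideal.subspace {f. eval f p = 0}"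
    unfolding ideal.subspace_def by simp
  then have "vanishing_ideal Z \<subseteq> {f. eval f p = 0}"
    unfolding vanishing_ideal_def using assms(2) by (intro ideal.span_minimal) auto
  then show ?thesis using assms(1) by auto
qed

text \<open>All derivatives of order less than \<open>j\<close> vanish at \<open>a\<close>. These
  conditions define an ideal and survive the cancellation of a factor that is nonzero at
  \<open>a\<close>, as the local definition of \<open>sections\<close> requires.\<close>

primrec vanishing_to_order :: "'k::field ^ 3 \<Rightarrow> nat \<Rightarrow> 'k ternary set" where
  "vanishing_to_order a 0 = UNIV"
| "vanishing_to_order a (Suc j) = {f. eval f a = 0 \<and> (\<forall>i. pd i f \<in> vanishing_to_order a j)}"

lemma vanishing_to_order_decreasing: "vanishing_to_order a (Suc j) \<subseteq> vanishing_to_order a j"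
  by (induction j) auto

lemma vanishing_to_order_add:
  "f \<in> vanishing_to_order a j \<Longrightarrow> g \<in> vanishing_to_order a j \<Longrightarrow> f + g \<in> vanishing_to_order a j"
  by (induction j arbitrary: f g) auto

lemma vanishing_to_order_zero: "0 \<in> vanishing_to_order a j"
  by (induction j) auto

lemma vanishing_to_order_times:
  "f \<in> vanishing_to_order a j \<Longrightarrow> g * f \<in> vanishing_to_order a j"
proof (induction j arbitrary: f g)
  case (Suc j)
  have "f \<in> vanishing_to_order a j"
    using Suc.prems vanishing_to_order_decreasing by blast
  then show ?case using Suc by (auto simp: pd_times intro!: vanishing_to_order_add)
qed simp

lemma subspace_vanishing_to_order: "ideal.subspace (vanishing_to_order a j)"
  unfolding ideal.subspace_def
  by (simp add: vanishing_to_order_zero vanishing_to_order_add vanishing_to_order_times)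

text \<open>In the Leibniz rule, either \<open>f\<close> is differentiated and \<open>g\<close>
  keeps its order, or \<open>g\<close> loses one order and the zero of \<open>f\<close> makes up for
  it.\<close>

lemma vanishing_to_order_prod:
  "eval f a = 0 \<Longrightarrow> g \<in> vanishing_to_order a j \<Longrightarrow> f * g \<in> vanishing_to_order a (Suc j)"
proof (induction j arbitrary: g)
  case (Suc j)
  have "f * pd i g \<in> vanishing_to_order a (Suc j)" for i
    using Suc by simp
  moreover have "pd i f * g \<in> vanishing_to_order a (Suc j)" for i
    using Suc.prems(2) by (rule vanishing_to_order_times)
  ultimately have "pd i (f * g) \<in> vanishing_to_order a (Suc j)" for i
    unfolding pd_times by (intro vanishing_to_order_add)
  then show ?case using Suc.prems(1) by (simp del: vanishing_to_order.simps(2) add: vanishing_to_order.simps(2)[of a "Suc j"])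
qed simp

text \<open>By induction \<open>f\<close> already vanishes to order \<open>j\<close>, so the Leibniz
  term \<open>pd i g * f\<close> can be subtracted from \<open>pd i (g * f)\<close>; what remains is
  \<open>g * pd i f\<close>, to which the induction hypothesis applies.\<close>

lemma vanishing_to_order_local:
  assumes "eval g a \<noteq> 0"
  shows "g * f \<in> vanishing_to_order a j \<Longrightarrow> f \<in> vanishing_to_order a j"
proof (induction j arbitrary: f)
  case (Suc j)
  have f: "f \<in> vanishing_to_order a j"
    by (rule Suc.IH) (rule subsetD[OF vanishing_to_order_decreasing Suc.prems])
  have "pd i f \<in> vanishing_to_order a j" for i
  proof (rule Suc.IH)
    have "pd i (g * f) \<in> vanishing_to_order a j" using Suc.prems by simp
    then have "pd i (g * f) + (- pd i g) * f \<in> vanishing_to_order a j"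
      by (rule vanishing_to_order_add[OF _ vanishing_to_order_times[OF f]])
    moreover have "pd i (g * f) + (- pd i g) * f = g * pd i f"
      by (simp add: pd_times)
    ultimately show "g * pd i f \<in> vanishing_to_order a j" by simp
  qed
  then show ?case using Suc.prems assms by simp
qed simp

lemma ideal_power_subset_vanishing_to_order:
  "ideal_power (vanishing_ideal {a}) j \<subseteq> vanishing_to_order a j"
proof (induction j)
  case (Suc j)
  have "ideal_prod (vanishing_ideal {a}) (ideal_power (vanishing_ideal {a}) j)
      \<subseteq> vanishing_to_order a (Suc j)"
    using Suc vanishing_ideal_eval[of _ "{a}" a]
    by (intro ideal_prod_subset subspace_vanishing_to_order vanishing_to_order_prod) auto
  then show ?case by simp
qed simp

text \<open>In coordinates with \<open>a\<close> as a base point, multiplicity at least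
  \<open>k + 1\<close> bounds the degree in the variable along \<open>a\<close> by
  \<open>r - 1\<close>. The induction avoids coordinates: the partial derivatives of the iterated
  derivative vanish, hence by Euler's identity in positive degree so does it.\<close>

lemma vanishing_to_order_imp_dir_deriv:
  fixes f :: "'k::field_char_0 ternary"
  shows "f \<in> forms (int (r + k)) \<Longrightarrow> f \<in> vanishing_to_order a (Suc k) \<Longrightarrow> (dir_deriv a ^^ r) f = 0"
proof (induction k arbitrary: f)
  case 0
  then have "(dir_deriv a ^^ r) f = const 0"
    using dir_deriv_funpow_full[of f r a] by simp
  then show ?case by (simp add: const_def)
next
  case (Suc k)
  let ?h = "(dir_deriv a ^^ r) f"
  have "pd i f \<in> forms (int (r + k))" for i using forms_pd[OF Suc.prems(1)] by simp
  then have "pd i ?h = 0" for i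
    using Suc.IH[of "pd i f"] Suc.prems(2) by (simp add: dir_deriv_funpow_pd)
  moreover have "?h \<in> forms (int (Suc k))"
    using forms_dir_deriv_funpow[OF Suc.prems(1), of r a] by simp
  ultimately have "scale (of_nat (Suc k)) ?h = 0"
    using euler_identity[of ?h "Suc k"] by simp
  then show ?case unfolding polys.scale_eq_0_iff by (simp del: of_nat_Suc)
qed

lemma const_inverse_times:
  assumes "c \<noteq> 0"
  shows "const (inverse c) * (const c * f) = f"
  using polys.scale_scale[of "inverse c" c f] assms by (simp only: scale_def left_inverse) (simp add: const_def)

text \<open>If \<open>a $ k \<noteq> 0\<close>, Euler's identity expresses \<open>f\<close> as a combination of \<open>dir_deriv a f\<close> and
  of the products of the \<open>pd i f\<close> with linear forms vanishing at \<open>a\<close>; both are of lower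
  degree.\<close>

lemma dir_deriv_imp_ideal_power:
  fixes f :: "'k::field_char_0 ternary"
  assumes "a \<noteq> 0"
  shows "f \<in> forms (int n) \<Longrightarrow> (dir_deriv a ^^ r) f = 0 \<Longrightarrow>
    f \<in> ideal_power (vanishing_ideal {a}) (n + 1 - r)"
proof (induction n arbitrary: f r)
  case 0
  show ?case
  proof (cases r)
    case 0
    then show ?thesis using "0.prems" ideal.subspace_0[OF subspace_ideal_power, of "vanishing_ideal {a}" 1] by simp
  qed simp
next
  case (Suc n)
  let ?I = "vanishing_ideal {a}"
  show ?case
  proof (cases r)
    case 0
    then have "f = 0" using Suc.prems(2) by simp
    then show ?thesis by (simp only: ideal.subspace_0[OF subspace_ideal_power])
  next
    case (Suc s)
    show ?thesis
    proof (cases "s \<le> n")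
      case False
      then show ?thesis using Suc by simp
    next
      case True
      from assms obtain k where k: "a $ k \<noteq> 0" by (auto simp: vec_eq_iff)
      let ?P = "ideal_power ?I (Suc (n - s))"
      have P: "ideal.subspace ?P" by (rule subspace_ideal_power)
      have "dir_deriv a f \<in> forms (int n)" using forms_dir_deriv[OF Suc.prems(1)] by simp
      moreover have "(dir_deriv a ^^ s) (dir_deriv a f) = 0"
        using Suc.prems(2) Suc by (simp add: funpow_swap1)
      ultimately have "dir_deriv a f \<in> ?P"
        using Suc.IH[of "dir_deriv a f" s] True by (simp add: Suc_diff_le)
      then have 1: "var k * dir_deriv a f \<in> ?P" by (rule ideal.subspace_scale[OF P])
      have 2: "(scale (a $ k) (var i) - scale (a $ i) (var k)) * pd i f \<in> ?P" for i
      proof -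
        have "pd i f \<in> forms (int n)" using forms_pd[OF Suc.prems(1)] by simp
        moreover have "(dir_deriv a ^^ r) (pd i f) = 0"
          by (simp only: dir_deriv_funpow_pd Suc.prems(2) pd_zero)
        ultimately have "pd i f \<in> ideal_power ?I (n + 1 - r)" by (rule Suc.IH)
        then have "pd i f \<in> ideal_power ?I (n - s)" using Suc by simp
        moreover have "scale (a $ k) (var i) - scale (a $ i) (var k) \<in> ?I"
          by (rule vanishing_ideal_mem[of _ 1]) (auto intro!: forms_diff forms_scale forms_var)
        ultimately show ?thesis by (simp add: ideal_prod_mem)
      qed
      have 3: "(\<Sum>i\<in>UNIV. (scale (a $ k) (var i) - scale (a $ i) (var k)) * pd i f) \<in> ?P"
        by (rule ideal.subspace_sum[OF P]) (rule 2)
      have "var k * dir_deriv a f + (\<Sum>i\<in>UNIV. (scale (a $ k) (var i) - scale (a $ i) (var k)) * pd i f)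
          = scale (a $ k) (\<Sum>i\<in>UNIV. var i * pd i f)"
        by (simp add: dir_deriv_def left_diff_distrib sum_subtractf sum_distrib_left polys.scale_sum_right)
      also have "\<dots> = scale (a $ k * of_nat (Suc n)) f"
        by (simp only: euler_identity[OF Suc.prems(1)] polys.scale_scale)
      finally have "const (a $ k * of_nat (Suc n)) * f \<in> ?P"
        using ideal.subspace_add[OF P 1 3] by (simp only: scale_def)
      moreover have "a $ k * of_nat (Suc n) \<noteq> 0" using k by (simp del: of_nat_Suc)
      ultimately have "f \<in> ?P"
        using ideal.subspace_scale[OF P] const_inverse_times by metis
      then show ?thesis using Suc True by (simp add: Suc_diff_le)
    qed
  qed
qed

section \<open>Sections of ideal sheaves\<close>

lemma linear_form_separating:
  fixes p q :: "'k::field ^ 3"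
  assumes "p \<noteq> 0" and "\<And>c. q \<noteq> c *s p"
  obtains g where "g \<in> forms 1" "eval g p = 0" "eval g q \<noteq> 0"
proof -
  from assms(1) obtain k where k: "p $ k \<noteq> 0" by (auto simp: vec_eq_iff)
  \<comment> \<open>These are two-by-two minors of the matrix with rows \<open>p\<close> and the
    variables. Since \<open>p $ k\<close> is nonzero, their common zeros are the multiples of
    \<open>p\<close>.\<close>
  define g where "g i = scale (p $ k) (var i) - scale (p $ i) (var k)" for i
  have "\<exists>i. eval (g i) q \<noteq> 0"
  proof (rule ccontr)
    assume "\<not> ?thesis"
    then have "p $ k * q $ i = p $ i * q $ k" for i by (simp add: g_def)
    then have "q $ i = q $ k / p $ k * p $ i" for i
      using k by (simp add: eq_divide_eq mult.commute)
    then have "q = (q $ k / p $ k) *s p"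
      unfolding vec_eq_iff vector_smult_component by (rule allI)
    with assms(2) show False by (rule notE)
  qed
  then obtain i where "eval (g i) q \<noteq> 0" by blast
  moreover have "g i \<in> forms 1" unfolding g_def by (intro forms_diff forms_scale forms_var)
  moreover have "eval (g i) p = 0" by (simp add: g_def)
  ultimately show ?thesis by (intro that)
qed

definition forms_through :: "('k::field ^ 3) set \<Rightarrow> nat \<Rightarrow> 'k ternary set" where
  "forms_through Z n = {f \<in> forms (int n). \<forall>z\<in>Z. eval f z = 0}"

lemma sections_vanishing_ideal:
  assumes "0 \<notin> Z"
  shows "sections (vanishing_ideal Z) (int n) = forms_through Z n"
proof
  show "sections (vanishing_ideal Z) (int n) \<subseteq> forms_through Z n"
  proof
    fix f assume f: "f \<in> sections (vanishing_ideal Z) (int n)"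
    have "eval f z = 0" if z: "z \<in> Z" for z
    proof -
      from z assms have "z \<noteq> 0" by auto
      with f obtain g where "eval g z \<noteq> 0" "g * f \<in> vanishing_ideal Z"
        unfolding sections_def by blast
      then show ?thesis using vanishing_ideal_eval[of "g * f" Z z] z by simp
    qed
    then show "f \<in> forms_through Z n" using f by (simp add: forms_through_def sections_def)
  qed
next
  show "forms_through Z n \<subseteq> sections (vanishing_ideal Z) (int n)"
  proof
    fix f assume f: "f \<in> forms_through Z n"
    then have "1 * f \<in> vanishing_ideal Z"
      using vanishing_ideal_mem[of f "int n" Z] by (simp add: forms_through_def)
    moreover have "eval 1 q \<noteq> 0" for q :: "'a ^ 3" by simp
    ultimately show "f \<in> sections (vanishing_ideal Z) (int n)"
      using f forms_one unfolding sections_def forms_through_def by blast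
  qed
qed

text \<open>The point \<open>p\<close> is off \<open>Z\<close>, so near any point of the plane at
  least one of the two ideals is trivial and their product agrees with their intersection there.
  Hence a section is a form lying in both ideals.\<close>

lemma sections_points_and_fat_point:
  fixes p :: "'k::field_char_0 ^ 3"
  assumes Z: "0 \<notin> Z" "finite Z" and p: "p \<noteq> 0" "\<And>z c. z \<in> Z \<Longrightarrow> p \<noteq> c *s z"
    and j: "0 < j" "j \<le> n"
  shows "sections (ideal_prod (vanishing_ideal Z) (ideal_power (vanishing_ideal {p}) j)) (int n)
    = {f \<in> forms_through Z n. (dir_deriv p ^^ (n + 1 - j)) f = 0}"
    (is "sections ?J _ = ?R")
proof
  show "sections ?J (int n) \<subseteq> ?R"
  proof
    fix f assume f: "f \<in> sections ?J (int n)"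
    have "?J \<subseteq> vanishing_ideal Z"
      by (rule ideal_prod_subset_left[OF subspace_vanishing_ideal])
    then have "f \<in> sections (vanishing_ideal Z) (int n)"
      using f unfolding sections_def by blast
    then have 1: "f \<in> forms_through Z n" by (simp add: sections_vanishing_ideal[OF Z(1)])
    obtain g where g: "eval g p \<noteq> 0" "g * f \<in> ?J"
      using f p(1) unfolding sections_def by blast
    have "?J \<subseteq> ideal_power (vanishing_ideal {p}) j"
      by (rule ideal_prod_subset_right[OF subspace_ideal_power])
    with g(2) have "g * f \<in> vanishing_to_order p j"
      using ideal_power_subset_vanishing_to_order by blast
    \<comment> \<open>The degree is split as \<open>n = (n + 1 - j) + (j - 1)\<close>:
      \<open>n + 1 - j\<close> derivations kill a form of multiplicity
      \<open>j = Suc (j - 1)\<close>.\<close>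
    then have "f \<in> vanishing_to_order p (Suc (j - 1))"
      using vanishing_to_order_local[OF g(1)] j by simp
    moreover have "f \<in> forms (int (n + 1 - j + (j - 1)))"
      using 1 j by (simp add: forms_through_def)
    ultimately have "(dir_deriv p ^^ (n + 1 - j)) f = 0"
      by (rule vanishing_to_order_imp_dir_deriv[rotated])
    with 1 show "f \<in> ?R" by simp
  qed
next
  show "?R \<subseteq> sections ?J (int n)"
  proof
    fix f assume f: "f \<in> ?R"
    then have forms: "f \<in> forms (int n)" by (simp add: forms_through_def)
    have "f \<in> ideal_power (vanishing_ideal {p}) (n + 1 - (n + 1 - j))"
      using f forms by (intro dir_deriv_imp_ideal_power[OF p(1)]) auto
    then have fp: "f \<in> ideal_power (vanishing_ideal {p}) j" using j by simp
    have fZ: "f \<in> vanishing_ideal Z"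
      using f vanishing_ideal_mem[OF forms, of Z] by (simp add: forms_through_def)
    have "\<exists>t. \<exists>g\<in>forms t. eval g q \<noteq> 0 \<and> g * f \<in> ?J" if q: "q \<noteq> 0" for q
    proof (cases "\<exists>c. q = c *s p")
      \<comment> \<open>At \<open>p\<close> itself the multiplier is a product of lines, one through
        each point of \<open>Z\<close>, none through \<open>p\<close>; it contributes the factor in
        the ideal of \<open>Z\<close>, and \<open>f\<close> the factor in the power of the ideal of
        \<open>p\<close>.\<close>
      case True
      then obtain c where c: "q = c *s p" by blast
      with q have "c \<noteq> 0" by auto
      have "\<exists>h. h \<in> forms 1 \<and> eval h z = 0 \<and> eval h p \<noteq> 0" if "z \<in> Z" for z
      proof -
        from that Z(1) have "z \<noteq> 0" by auto
        from linear_form_separating[OF this p(2)[OF that]] show ?thesis by blast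
      qed
      then obtain h where h: "\<And>z. z \<in> Z \<Longrightarrow> h z \<in> forms 1 \<and> eval (h z) z = 0 \<and> eval (h z) p \<noteq> 0"
        by metis
      let ?g = "\<Prod>z\<in>Z. h z"
      have g: "?g \<in> forms (int (card Z))" using h by (intro forms_prod_linear) blast
      have "?g \<in> vanishing_ideal Z"
        by (rule vanishing_ideal_mem[OF g]) (use h Z(2) in auto)
      then have "?g * f \<in> ?J" using fp by (rule ideal_prod_mem)
      moreover have "eval ?g q \<noteq> 0"
        unfolding c eval_forms_scaled[OF g] using \<open>c \<noteq> 0\<close> h Z(2) by auto
      ultimately show ?thesis using g by blast
    next
      \<comment> \<open>Away from \<open>p\<close> the roles are exchanged: the \<open>j\<close>-th
        power of a line through \<open>p\<close> is the multiplier, and \<open>f\<close> contributes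
        the factor in the ideal of \<open>Z\<close>.\<close>
      case False
      then obtain g where g: "g \<in> forms 1" "eval g p = 0" "eval g q \<noteq> 0"
        using linear_form_separating[OF p(1), of q] by blast
      have "g \<in> vanishing_ideal {p}" using g by (intro vanishing_ideal_mem) auto
      then have "f * g ^ j \<in> ?J" using fZ by (intro ideal_prod_mem ideal_power_mem)
      then have "g ^ j * f \<in> ?J" by (simp add: mult.commute)
      then show ?thesis using g(3) forms_power[OF g(1), of j]
        by (intro exI[of _ "int j * 1"] bexI[of _ "g ^ j"]) auto
    qed
    then show "f \<in> sections ?J (int n)" using forms by (simp add: sections_def)
  qed
qed

section \<open>General points\<close>

text \<open>Complements of single curves form a basis of the Zariski topology, so one form that is
  not identically zero can witness generality.\<close>

lemma general_point_iff:
  "general_point Q \<longleftrightarrow> (\<exists>t. \<exists>F\<in>forms t. (\<exists>p. p \<noteq> 0 \<and> eval F p \<noteq> 0) \<and>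
     (\<forall>p. p \<noteq> 0 \<and> eval F p \<noteq> 0 \<longrightarrow> Q p))" (is "_ \<longleftrightarrow> ?R")
proof
  assume "general_point Q"
  then obtain C where C: "zariski_closed C" "C \<noteq> {p. p \<noteq> 0}" "\<forall>p. p \<noteq> 0 \<and> p \<notin> C \<longrightarrow> Q p"
    unfolding general_point_def by auto
  from C(1) obtain S where S: "\<forall>f\<in>S. \<exists>t. f \<in> forms t"
    and C_eq: "C = {p. p \<noteq> 0 \<and> (\<forall>f\<in>S. eval f p = 0)}"
    unfolding zariski_closed_def by auto
  have "\<exists>p F. p \<noteq> 0 \<and> F \<in> S \<and> eval F p \<noteq> 0"
  proof (rule ccontr)
    assume "\<not> ?thesis"
    then have "C = {p. p \<noteq> 0}" unfolding C_eq by auto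
    with C(2) show False by (rule notE)
  qed
  then obtain p F where p: "p \<noteq> 0" "F \<in> S" "eval F p \<noteq> 0" by auto
  with S obtain t where t: "F \<in> forms t" by auto
  have "Q q" if "q \<noteq> 0" "eval F q \<noteq> 0" for q
  proof -
    have "q \<notin> C" unfolding C_eq using that(2) p(2) by auto
    then show ?thesis using C(3) that(1) by simp
  qed
  then show ?R using p(1,3) by (intro exI[of _ t] bexI[OF _ t]) auto
next
  assume ?R
  then obtain t F p where F: "F \<in> forms t" "p \<noteq> 0" "eval F p \<noteq> 0"
    "\<forall>p. p \<noteq> 0 \<and> eval F p \<noteq> 0 \<longrightarrow> Q p" by auto
  let ?C = "{p. p \<noteq> 0 \<and> eval F p = 0}"
  have "zariski_closed ?C"
    unfolding zariski_closed_def using F(1) by (intro exI[of _ "{F}"]) auto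
  moreover have "p \<notin> ?C" "p \<in> {p. p \<noteq> 0}" using F(2,3) by simp_all
  then have "?C \<noteq> {p. p \<noteq> 0}" by fastforce
  moreover have "\<forall>p. p \<noteq> 0 \<and> p \<notin> ?C \<longrightarrow> Q p" using F(4) by auto
  ultimately show "general_point Q"
    unfolding general_point_def by (intro exI[of _ ?C] conjI)
qed

lemma general_point_mono: "general_point Q \<Longrightarrow> (\<And>p. p \<noteq> 0 \<Longrightarrow> Q p \<Longrightarrow> Q' p) \<Longrightarrow> general_point Q'"
  unfolding general_point_iff by meson

lemma general_point_True: "general_point (\<lambda>p. True)"
  unfolding general_point_iff
  by (intro exI[of _ 0] bexI[of _ 1]) (auto simp: forms_one intro!: exI[of _ "\<chi> i. 1"] simp: vec_eq_iff)

lemma general_pointD: "general_point Q \<Longrightarrow> \<exists>p. p \<noteq> 0 \<and> Q p"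
  unfolding general_point_iff by blast

definition line_restriction :: "'k::field ^ 3 \<Rightarrow> 'k ^ 3 \<Rightarrow> 'k ternary \<Rightarrow> 'k poly" where
  "line_restriction p q f =
     (\<Sum>m\<in>keys f. smult (lookup f m) (\<Prod>i\<in>UNIV. [:p $ i, q $ i - p $ i:] ^ lookup m i))"

lemma poly_line_restriction:
  "poly (line_restriction p q f) t = eval f (\<chi> i. p $ i + t * (q $ i - p $ i))"
  by (simp add: line_restriction_def eval_def poly_sum poly_prod)

text \<open>The plane is irreducible: on the line through points where two forms do not vanish,
  each of them has finitely many zeros.\<close>

lemma general_point_conj:
  fixes Q Q' :: "'k::field_char_0 ^ 3 \<Rightarrow> bool"
  assumes "general_point Q" "general_point Q'"
  shows "general_point (\<lambda>p. Q p \<and> Q' p)"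
proof -
  from assms(1) obtain s F p where F: "F \<in> forms s" "p \<noteq> 0" "eval F p \<noteq> 0"
      "\<And>p. p \<noteq> 0 \<and> eval F p \<noteq> 0 \<longrightarrow> Q p"
    unfolding general_point_iff by auto
  from assms(2) obtain t G q where G: "G \<in> forms t" "q \<noteq> 0" "eval G q \<noteq> 0"
      "\<And>p. p \<noteq> 0 \<and> eval G p \<noteq> 0 \<longrightarrow> Q' p"
    unfolding general_point_iff by auto
  from F(2) obtain k where k: "p $ k \<noteq> 0" by (auto simp: vec_eq_iff)
  \<comment> \<open>The third factor is the \<open>k\<close>-th coordinate of the moving point; it
    keeps the chosen point nonzero, so that it represents a point of the plane.\<close>
  let ?P = "line_restriction p q F * line_restriction p q G * [:p $ k, q $ k - p $ k:]"
  have "(\<chi> i. p $ i + 0 * (q $ i - p $ i)) = p" "(\<chi> i. p $ i + 1 * (q $ i - p $ i)) = q"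
    by (simp_all add: vec_eq_iff)
  then have "poly (line_restriction p q F) 0 \<noteq> 0" "poly (line_restriction p q G) 1 \<noteq> 0"
    unfolding poly_line_restriction using F(3) G(3) by simp_all
  then have "line_restriction p q F \<noteq> 0" "line_restriction p q G \<noteq> 0" by auto
  moreover have "[:p $ k, q $ k - p $ k:] \<noteq> 0" using k by simp
  ultimately have "?P \<noteq> 0" by (intro no_zero_divisors)
  then have "finite {t. poly ?P t = 0}" by (rule poly_roots_finite)
  then obtain c where c: "poly ?P c \<noteq> 0"
    using infinite_UNIV_char_0[where 'a = 'k] ex_new_if_finite by blast
  define r where "r = (\<chi> i. p $ i + c * (q $ i - p $ i))"
  have "eval F r * eval G r * r $ k \<noteq> 0"
    using c unfolding poly_mult poly_line_restriction by (simp add: r_def mult.commute[of c])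
  then have "r \<noteq> 0" "eval (F * G) r \<noteq> 0" by auto
  moreover have "Q p \<and> Q' p" if "p \<noteq> 0" "eval (F * G) p \<noteq> 0" for p
    using that F(4) G(4) by auto
  ultimately show ?thesis
    unfolding general_point_iff
    by (intro exI[of _ "s + t"] bexI[OF _ forms_times[OF F(1) G(1)]] conjI exI[of _ r]) auto
qed

lemma general_point_Ball:
  fixes Q :: "'i \<Rightarrow> 'k::field_char_0 ^ 3 \<Rightarrow> bool"
  assumes "finite A" "\<And>i. i \<in> A \<Longrightarrow> general_point (Q i)"
  shows "general_point (\<lambda>p. \<forall>i\<in>A. Q i p)"
  using assms
proof (induction A)
  case empty
  then show ?case by (simp add: general_point_True)
next
  case (insert x A)
  have "general_point (Q x)" "general_point (\<lambda>p. \<forall>i\<in>A. Q i p)"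
    using insert by simp_all
  from general_point_conj[OF this] show ?case by simp
qed

text \<open>A linear form that vanishes at \<open>z\<close> vanishes at all multiples of
  \<open>z\<close>, so the complement of such a line is a suitable open set; for
  \<open>z = 0\<close> any nonzero linear form serves.\<close>

lemma general_point_not_multiple:
  fixes z :: "'k::field ^ 3"
  shows "general_point (\<lambda>p. \<forall>c. p \<noteq> c *s z)"
proof -
  have "\<exists>g q. g \<in> forms 1 \<and> eval g z = 0 \<and> q \<noteq> 0 \<and> eval g q \<noteq> 0"
  proof (cases "z = 0")
    case True
    have *: "(axis 1 1 :: 'k ^ 3) $ 1 = 1" by (simp add: axis_def)
    then have "(axis 1 1 :: 'k ^ 3) \<noteq> 0" by (metis zero_index zero_neq_one)
    with True * show ?thesis
      by (intro exI[of _ "var 1"] exI[of _ "axis 1 1"]) (simp add: forms_var)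
  next
    case False
    then obtain k where k: "z $ k \<noteq> 0" by (auto simp: vec_eq_iff)
    have "UNIV \<noteq> {k}"
    proof
      assume "UNIV = {k}"
      then have "CARD(3) = card {k}" by simp
      then show False by simp
    qed
    then obtain k' where k': "k' \<noteq> k" by blast
    let ?q = "axis k' 1 :: 'k ^ 3"
    have q: "?q \<noteq> c *s z" for c
    proof
      assume *: "?q = c *s z"
      from arg_cong[OF *, of "\<lambda>v. v $ k"] have "c = 0" using k k' by (simp add: axis_def)
      with arg_cong[OF *, of "\<lambda>v. v $ k'"] show False by (simp add: axis_def)
    qed
    obtain g where g: "g \<in> forms 1" "eval g z = 0" "eval g ?q \<noteq> 0"
      by (rule linear_form_separating[OF False q])
    have "?q \<noteq> 0" using q[of 0] by simp
    with g show ?thesis by (intro exI[of _ g] exI[of _ ?q]) simp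
  qed
  then obtain g q where g: "g \<in> forms 1" "eval g z = 0" "q \<noteq> 0" "eval g q \<noteq> 0" by blast
  have "p \<noteq> c *s z" if "eval g p \<noteq> 0" for p c
  proof
    assume "p = c *s z"
    then show False using that g(2) eval_forms_scaled[of g 1 c z] g(1) by simp
  qed
  then show ?thesis unfolding general_point_iff
    using g by (intro exI[of _ 1] bexI[OF _ g(1)] conjI exI[of _ q]) simp_all
qed

section \<open>Semicontinuity of ranks\<close>

text \<open>Gaussian elimination with polynomial entries: the form \<open>F\<close> is the product of the pivots
  chosen at \<open>p0\<close>.\<close>

lemma independence_open:
  fixes v :: "'i \<Rightarrow> 'c \<Rightarrow> 'k::field ternary"
  assumes "finite A" "\<And>i. i \<in> A \<Longrightarrow> \<exists>t. \<forall>c. v i c \<in> forms t"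
    and "\<And>x. (\<forall>c. (\<Sum>i\<in>A. x i * eval (v i c) p0) = 0) \<Longrightarrow> \<forall>i\<in>A. x i = 0"
  shows "\<exists>t. \<exists>F\<in>forms t. eval F p0 \<noteq> 0 \<and> (\<forall>p x. eval F p \<noteq> 0 \<longrightarrow>
    (\<forall>c. (\<Sum>i\<in>A. x i * eval (v i c) p) = 0) \<longrightarrow> (\<forall>i\<in>A. x i = 0))"
  using assms
proof (induction A arbitrary: v)
  case empty
  show ?case by (intro exI[of _ 0] bexI[of _ 1]) (auto simp: forms_one)
next
  case (insert a A)
  have "\<exists>c. eval (v a c) p0 \<noteq> 0"
  proof (rule ccontr)
    assume "\<not> ?thesis"
    then have "(\<Sum>i\<in>insert a A. (if i = a then 1 else 0) * eval (v i c) p0) = 0" for c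
      by (intro sum.neutral) simp
    then have "\<forall>i\<in>insert a A. (if i = a then 1 else 0) = (0::'k)"
      by (intro insert.prems(2)) simp
    then show False by simp
  qed
  then obtain b where b: "eval (v a b) p0 \<noteq> 0" by auto
  \<comment> \<open>Cross-multiplication instead of division by the pivot keeps the entries
    homogeneous, with one degree per row \<open>i\<close>.\<close>
  define w where "w i c = v a b * v i c - v i b * v a c" for i c
  obtain s where s: "\<forall>c. v a c \<in> forms s" using insert.prems(1)[of a] by auto
  have w_forms: "\<exists>t. \<forall>c. w i c \<in> forms t" if "i \<in> A" for i
  proof -
    obtain t where t: "\<forall>c. v i c \<in> forms t" using insert.prems(1)[of i] \<open>i \<in> A\<close> by auto
    have "w i c \<in> forms (s + t)" for c
      unfolding w_def using s t forms_times[of "v a b" s "v i c" t] forms_times[of "v i b" t "v a c" s]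
      by (intro forms_diff) (simp_all add: add.commute)
    then show ?thesis by blast
  qed
  have w_sum: "(\<Sum>i\<in>A. x i * eval (w i c) p)
      = eval (v a b) p * (\<Sum>i\<in>A. x i * eval (v i c) p) - (\<Sum>i\<in>A. x i * eval (v i b) p) * eval (v a c) p"
    for x p c
    by (simp add: w_def sum_distrib_left sum_distrib_right sum_subtractf algebra_simps)
  have w_indep: "\<forall>i\<in>A. x i = 0" if x: "\<forall>c. (\<Sum>i\<in>A. x i * eval (w i c) p0) = 0" for x
  proof -
    \<comment> \<open>A relation among the reduced rows lifts to one among the original rows; the
      coefficient of row \<open>a\<close> is the one dictated by \<open>w_sum\<close>.\<close>
    define y where "y i = (if i = a then - (\<Sum>i\<in>A. x i * eval (v i b) p0) else eval (v a b) p0 * x i)" for i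
    have "(\<Sum>i\<in>insert a A. y i * eval (v i c) p0) = 0" for c
    proof -
      have "(\<Sum>i\<in>A. y i * eval (v i c) p0) = (\<Sum>i\<in>A. eval (v a b) p0 * (x i * eval (v i c) p0))"
        using insert.hyps by (intro sum.cong) (auto simp: y_def)
      then have "(\<Sum>i\<in>insert a A. y i * eval (v i c) p0) = (\<Sum>i\<in>A. x i * eval (w i c) p0)"
        using insert.hyps by (simp add: w_sum y_def sum_distrib_left[symmetric])
      with x show ?thesis by simp
    qed
    then have "\<forall>i\<in>insert a A. y i = 0" by (intro insert.prems(2)) simp
    then have "eval (v a b) p0 * x i = 0" if "i \<in> A" for i
      using that insert.hyps by (auto simp: y_def split: if_splits)
    then show ?thesis using b by simp
  qed
  from insert.IH[of w, OF w_forms w_indep] obtain t F where F: "F \<in> forms t" "eval F p0 \<noteq> 0"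
    "\<And>p x. eval F p \<noteq> 0 \<Longrightarrow> (\<forall>c. (\<Sum>i\<in>A. x i * eval (w i c) p) = 0) \<Longrightarrow> \<forall>i\<in>A. x i = 0"
    by auto
  have "\<forall>i\<in>insert a A. x i = 0"
    if p: "eval (v a b * F) p \<noteq> 0" and x: "\<forall>c. (\<Sum>i\<in>insert a A. x i * eval (v i c) p) = 0" for p x
  proof -
    have sum: "(\<Sum>i\<in>A. x i * eval (v i c) p) = - (x a * eval (v a c) p)" for c
      using x[rule_format, of c] insert.hyps by (simp add: eq_neg_iff_add_eq_0 add.commute)
    have "(\<Sum>i\<in>A. x i * eval (w i c) p) = 0" for c
      unfolding w_sum sum by (simp add: algebra_simps)
    then have A: "\<forall>i\<in>A. x i = 0" using F(3)[of p x] p by simp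
    then have "(\<Sum>i\<in>A. x i * eval (v i b) p) = 0" by (intro sum.neutral) simp
    then have "x a = 0" using sum[of b] p by simp
    with A show ?thesis by simp
  qed
  moreover have "eval (v a b * F) p0 \<noteq> 0" using b F(2) by simp
  ultimately show ?case
    using forms_times[OF s[rule_format, of b] F(1)] by (intro exI[of _ "s + t"] bexI[of _ "v a b * F"]) simp_all
qed

lemma (in vector_space) independent_family:
  assumes "finite A" and ind: "\<And>x. (\<Sum>i\<in>A. scale (x i) (w i)) = 0 \<Longrightarrow> \<forall>i\<in>A. x i = 0"
  shows "inj_on w A" "independent (w ` A)"
proof -
  show inj: "inj_on w A"
  proof (rule inj_onI, rule ccontr)
    fix i j assume ij: "i \<in> A" "j \<in> A" "w i = w j" "i \<noteq> j"
    define x :: "_ \<Rightarrow> 'a" where "x k = (if k = i then 1 else 0) - (if k = j then 1 else 0)" for k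
    have "(\<Sum>k\<in>A. scale (x k) (w k))
        = (\<Sum>k\<in>A. (if k = i then w k else 0) - (if k = j then w k else 0))"
      by (intro sum.cong) (auto simp: x_def)
    also have "\<dots> = 0" using ij assms(1) by (simp add: sum_subtractf)
    finally have "x i = 0" using ind ij(1) by blast
    then show False using ij(4) by (simp add: x_def)
  qed
  show "independent (w ` A)"
  proof (rule independent_if_scalars_zero)
    fix u v assume "(\<Sum>v\<in>w ` A. scale (u v) v) = 0" and v: "v \<in> w ` A"
    then have "(\<Sum>i\<in>A. scale (u (w i)) (w i)) = 0" by (simp add: sum.reindex[OF inj])
    then have "\<forall>i\<in>A. u (w i) = 0" by (rule ind)
    with v show "u v = 0" by auto
  qed (use assms(1) in simp)
qed

text \<open>Each coefficient is a form in the coordinates of \<open>p\<close>, of a degree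
  independent of \<open>u\<close> and \<open>c\<close>; such entries are what
  \<open>independence_open\<close> accepts. One linear factor at a time is expanded into variables
  and absorbed into \<open>u\<close>.\<close>

lemma lookup_linear_form_power_times:
  "\<exists>G\<in>forms (int k). \<forall>p. lookup (linear_form p ^ k * u) c = eval G p"
proof (induction k arbitrary: u)
  case 0
  show ?case by (rule bexI[of _ "const (lookup u c)"]) (simp_all add: forms_const)
next
  case (Suc k)
  have "\<forall>i. \<exists>G. G \<in> forms (int k) \<and> (\<forall>p. lookup (linear_form p ^ k * (var i * u)) c = eval G p)"
    using Suc.IH by blast
  from choice[OF this] obtain G where G: "\<And>i. G i \<in> forms (int k)"
    "\<And>i p. lookup (linear_form p ^ k * (var i * u)) c = eval (G i) p" by auto
  have *: "linear_form p ^ Suc k * u = (\<Sum>i\<in>UNIV. scale (p $ i) (linear_form p ^ k * (var i * u)))" for p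
  proof -
    have "linear_form p ^ Suc k * u = linear_form p ^ k * (linear_form p * u)"
      by (simp add: mult_ac)
    also have "linear_form p * u = (\<Sum>i\<in>UNIV. scale (p $ i) (var i * u))"
      by (simp add: linear_form_def sum_distrib_right)
    finally show ?thesis by (simp add: sum_distrib_left)
  qed
  have "lookup (linear_form p ^ Suc k * u) c = eval (\<Sum>i\<in>UNIV. var i * G i) p" for p
    unfolding * by (simp add: lookup_sum G)
  moreover have "(\<Sum>i\<in>UNIV. var i * G i) \<in> forms (int (Suc k))"
    using forms_times[OF forms_var G(1)] by (intro forms_sum) simp
  ultimately show ?case by blast
qed

text \<open>A basis at \<open>p0\<close> is taken from the union itself. Each of its vectors either
  lies in \<open>W\<close> and stays fixed, or is a multiple of the power of the linear form and
  moves with \<open>p\<close>; independence persists on an open set.\<close>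

lemma dim_Un_linear_form_power_semicontinuous:
  fixes W U :: "'k::field ternary set"
  assumes W: "W \<subseteq> forms (int n)" and U: "\<And>p. (*) (linear_form p ^ k) ` U \<subseteq> forms (int n)"
  shows "\<exists>t. \<exists>F\<in>forms t. eval F p0 \<noteq> 0 \<and> (\<forall>p. eval F p \<noteq> 0 \<longrightarrow>
    polys.dim (W \<union> (*) (linear_form p0 ^ k) ` U) \<le> polys.dim (W \<union> (*) (linear_form p ^ k) ` U))"
proof -
  let ?S = "\<lambda>p. W \<union> (*) (linear_form p ^ k) ` U"
  have span: "?S p \<subseteq> polys.span (monomials n)" for p
    using W U unfolding span_monomials by auto
  obtain B where B: "B \<subseteq> ?S p0" "polys.independent B" "card B = polys.dim (?S p0)" "finite B"
    using polys.finite_basis_exists[OF span finite_monomials] by blast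
  \<comment> \<open>\<open>V\<close> is the vector \<open>b\<close> moving with \<open>p\<close>
    inside the union, and \<open>G\<close> gives its coefficients as forms in \<open>p\<close>, all
    of the same degree \<open>t\<close>.\<close>
  define good where "good b = (\<lambda>(V, G, t). (\<forall>p. V p \<in> ?S p) \<and> V p0 = b \<and>
     (\<forall>c. G c \<in> forms t \<and> (\<forall>p. lookup (V p) c = eval (G c) p)))"
    for b and VGt :: "('k ^ 3 \<Rightarrow> 'k ternary) \<times> ((3 \<Rightarrow>\<^sub>0 nat) \<Rightarrow> 'k ternary) \<times> int"
  have "\<exists>VGt. good b VGt" if "b \<in> B" for b
  proof (cases "b \<in> W")
    case True
    then have "good b (\<lambda>p. b, \<lambda>c. const (lookup b c), 0)"
      by (simp add: good_def forms_const)
    then show ?thesis by blast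
  next
    case False
    then obtain u where u: "u \<in> U" "b = linear_form p0 ^ k * u" using \<open>b \<in> B\<close> B(1) by auto
    have "\<forall>c. \<exists>G. G \<in> forms (int k) \<and> (\<forall>p. lookup (linear_form p ^ k * u) c = eval G p)"
      using lookup_linear_form_power_times by blast
    from choice[OF this] obtain G where
      "\<forall>c. G c \<in> forms (int k) \<and> (\<forall>p. lookup (linear_form p ^ k * u) c = eval (G c) p)" by auto
    moreover have "linear_form p ^ k * u \<in> (*) (linear_form p ^ k) ` U" for p
      using u(1) by (rule imageI)
    ultimately have "good b (\<lambda>p. linear_form p ^ k * u, G, int k)"
      using u(2) by (simp add: good_def)
    then show ?thesis by blast
  qed
  then have "\<forall>b. \<exists>VGt. b \<in> B \<longrightarrow> good b VGt" by blast
  from choice[OF this] obtain f where f: "\<And>b. b \<in> B \<Longrightarrow> good b (f b)" by auto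
  define V G t where "V b = fst (f b)" and "G b = fst (snd (f b))" and "t b = snd (snd (f b))" for b
  have V: "V b p \<in> ?S p" "V b p0 = b" and G: "G b c \<in> forms (t b)" "lookup (V b p) c = eval (G b c) p"
    if "b \<in> B" for b p c
    using f[OF that] by (simp_all add: good_def V_def G_def t_def split_beta)
  have coords: "(\<Sum>b\<in>B. scale (x b) (V b p)) = 0 \<longleftrightarrow> (\<forall>c. (\<Sum>b\<in>B. x b * eval (G b c) p) = 0)" for x p
    by (simp add: poly_mapping_eq_iff fun_eq_iff lookup_sum G(2) cong: sum.cong)
  have "\<exists>s. \<exists>F\<in>forms s. eval F p0 \<noteq> 0 \<and> (\<forall>p x. eval F p \<noteq> 0 \<longrightarrow>
    (\<forall>c. (\<Sum>b\<in>B. x b * eval (G b c) p) = 0) \<longrightarrow> (\<forall>b\<in>B. x b = 0))"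
  proof (rule independence_open[OF B(4)])
    fix x assume "\<forall>c. (\<Sum>b\<in>B. x b * eval (G b c) p0) = 0"
    then have "(\<Sum>b\<in>B. scale (x b) (V b p0)) = 0" unfolding coords .
    then have "(\<Sum>b\<in>B. scale (x b) b) = 0" using V(2) by (simp cong: sum.cong)
    then show "\<forall>b\<in>B. x b = 0" using polys.independentD[OF B(2,4) subset_refl] by blast
  qed (use G(1) in blast)
  then obtain s F where F: "F \<in> forms s" "eval F p0 \<noteq> 0"
    "\<And>p x. eval F p \<noteq> 0 \<Longrightarrow> (\<forall>c. (\<Sum>b\<in>B. x b * eval (G b c) p) = 0) \<Longrightarrow> \<forall>b\<in>B. x b = 0"
    by auto
  have "polys.dim (?S p0) \<le> polys.dim (?S p)" if p: "eval F p \<noteq> 0" for p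
  proof -
    have ind: "\<forall>b\<in>B. x b = 0" if "(\<Sum>b\<in>B. scale (x b) (V b p)) = 0" for x
      using F(3)[OF p] that unfolding coords by blast
    note fam = polys.independent_family[OF B(4), of "\<lambda>b. V b p", OF ind]
    have "(\<lambda>b. V b p) ` B \<subseteq> ?S p" using V(1) by blast
    from polys.card_le_dim_finite_span[OF this fam(2) span finite_monomials]
    show ?thesis using card_image[OF fam(1)] B(3) by simp
  qed
  then show ?thesis using F(1,2) by blast
qed

text \<open>The dimension is bounded, so it attains a maximum at some \<open>p0\<close>;
  semicontinuity at \<open>p0\<close> together with maximality makes it constant on an open
  set.\<close>

lemma dim_Un_linear_form_power_generic:
  fixes W U :: "'k::field_char_0 ternary set"
  assumes W: "W \<subseteq> forms (int n)" and U: "\<And>p. (*) (linear_form p ^ k) ` U \<subseteq> forms (int n)"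
  shows "\<exists>r. general_point (\<lambda>p. polys.dim (W \<union> (*) (linear_form p ^ k) ` U) = r)"
proof -
  define s where "s p = polys.dim (W \<union> (*) (linear_form p ^ k) ` U)" for p
  have "s p \<le> card (monomials n :: 'k ternary set)" for p
    unfolding s_def using W U[of p] finite_monomials by (intro polys.dim_le_card) (auto simp: span_monomials)
  then have bound: "\<forall>p. p \<noteq> 0 \<longrightarrow> s p < Suc (card (monomials n :: 'k ternary set))" by (simp add: less_Suc_eq_le)
  obtain q :: "'k ^ 3" where "q \<noteq> 0" using general_pointD[OF general_point_True] by blast
  from ex_has_greatest_nat[of "\<lambda>p. p \<noteq> 0", OF this bound]
  obtain p0 where p0: "p0 \<noteq> 0" "\<And>p. p \<noteq> 0 \<Longrightarrow> s p \<le> s p0" by auto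
  obtain t F where F: "F \<in> forms t" "eval F p0 \<noteq> 0" "\<And>p. eval F p \<noteq> 0 \<Longrightarrow> s p0 \<le> s p"
    using dim_Un_linear_form_power_semicontinuous[OF W U, of p0] unfolding s_def by auto
  have "general_point (\<lambda>p. s p = s p0)"
    unfolding general_point_iff using F p0 le_antisym by blast
  then show ?thesis unfolding s_def by blast
qed

section \<open>Osculating spaces of the Veronese surface\<close>

text \<open>Since \<open>\<delta> P\<close> is a constant of the derivation, only the power of
  \<open>P\<close> gets differentiated; \<open>e\<close> is the falling factorial
  \<open>(n + i)! / n!\<close>. An abstract derivation covers the derivatives in both chart
  variables.\<close>

lemma derivation_funpow_power:
  fixes \<delta> :: "'r::comm_ring_1 \<Rightarrow> 'r"
  assumes add: "\<And>x y. \<delta> (x + y) = \<delta> x + \<delta> y" and mult: "\<And>x y. \<delta> (x * y) = \<delta> x * y + x * \<delta> y"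
    and P: "\<delta> (\<delta> P) = 0"
  shows "\<exists>e::nat. e \<noteq> 0 \<and> (\<delta> ^^ i) (P ^ (n + i)) = of_nat e * \<delta> P ^ i * P ^ n"
proof -
  have zero: "\<delta> 0 = 0" using add[of 0 0] by simp
  have one: "\<delta> 1 = 0" using mult[of 1 1] by simp
  have of_nat: "\<delta> (of_nat e) = 0" for e :: nat by (induction e) (simp_all add: zero one add)
  have const: "\<delta> (\<delta> P ^ i) = 0" for i by (induction i) (simp_all add: one mult P)
  have power: "\<delta> (P ^ Suc n) = of_nat (Suc n) * \<delta> P * P ^ n" for n
    by (induction n) (simp_all add: mult algebra_simps)
  show ?thesis
  proof (induction i arbitrary: n)
    case 0
    show ?case by (intro exI[of _ 1]) simp
  next
    case (Suc i)
    from Suc.IH[of "Suc n"] obtain e :: nat where e: "e \<noteq> 0"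
      "(\<delta> ^^ i) (P ^ (Suc n + i)) = of_nat e * \<delta> P ^ i * P ^ Suc n" by blast
    have "(\<delta> ^^ Suc i) (P ^ (n + Suc i)) = \<delta> (of_nat e * \<delta> P ^ i * P ^ Suc n)"
      using e(2) by simp
    also have "\<dots> = of_nat e * \<delta> P ^ i * \<delta> (P ^ Suc n)"
      by (simp only: mult of_nat const) simp
    also have "\<dots> = of_nat (e * Suc n) * \<delta> P ^ Suc i * P ^ n"
      unfolding power of_nat_mult by (simp only: power_Suc mult_ac)
    finally show ?case using e(1) by (intro exI[of _ "e * Suc n"]) simp
  qed
qed

lemma map_poly_pderiv_add:
  "map_poly pderiv (p + q) = map_poly pderiv p + map_poly pderiv (q :: 'a::idom poly poly)"
  by (rule poly_eqI) (simp add: coeff_map_poly pderiv_add)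

lemma map_poly_pderiv_mult:
  "map_poly pderiv (p * q) = map_poly pderiv p * q + p * map_poly pderiv (q :: 'a::idom poly poly)"
proof (induction p)
  case (pCons a p)
  have smult: "map_poly pderiv (smult a q) = smult (pderiv a) q + smult a (map_poly pderiv q)"
    by (rule poly_eqI) (simp add: coeff_map_poly pderiv_mult algebra_simps)
  have shift: "map_poly pderiv (pCons a p) = pCons (pderiv a) (map_poly pderiv p)" for a and p :: "'a poly poly"
    by (rule poly_eqI) (simp add: coeff_map_poly coeff_pCons split: nat.splits)
  show ?case
    by (simp add: map_poly_pderiv_add smult shift pCons.IH algebra_simps)
qed simp

lemma pderiv_funpow_constant_mult:
  "pderiv K = 0 \<Longrightarrow> (pderiv ^^ j) (K * X) = K * (pderiv ^^ j) (X :: 'a::idom poly)"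
  by (induction j) (simp_all add: pderiv_mult)

lemma deriv_point_veronese_param:
  fixes L0 L1 L2 :: "'k::field ternary"
  shows "\<exists>e::nat. e \<noteq> 0 \<and>
    deriv_point (veronese_param (n + j + i) L0 L1 L2) i j = of_nat e * (L0 ^ n * L1 ^ i * L2 ^ j)"
proof -
  let ?P = "[:[:L0, L1:], [:L2:]:]" and ?D = "map_poly pderiv :: 'k ternary poly poly \<Rightarrow> _"
  have DP: "?D ?P = [:[:L1:]:]" "?D (?D ?P) = 0" by (simp_all add: map_poly_pCons pderiv_pCons)
  have dP: "pderiv ?P = [:[:L2:]:]" "pderiv (pderiv ?P) = 0" by (simp_all add: pderiv_pCons)
  obtain e1 :: nat where e1: "e1 \<noteq> 0"
      "(?D ^^ i) (?P ^ (n + j + i)) = of_nat e1 * [:[:L1:]:] ^ i * ?P ^ (n + j)"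
    using derivation_funpow_power[OF map_poly_pderiv_add map_poly_pderiv_mult DP(2), of i "n + j"]
    unfolding DP(1) by blast
  obtain e2 :: nat where e2: "e2 \<noteq> 0"
      "(pderiv ^^ j) (?P ^ (n + j)) = of_nat e2 * [:[:L2:]:] ^ j * ?P ^ n"
    using derivation_funpow_power[of pderiv ?P j n, OF pderiv_add _ dP(2)]
    unfolding dP(1) by (auto simp: pderiv_mult algebra_simps)
  \<comment> \<open>The factor produced by differentiating in the inner variable is constant in the
    outer one and can be pulled out.\<close>
  have K: "pderiv (of_nat e1 * [:[:L1:]:] ^ i) = 0"
    by (simp add: pderiv_mult pderiv_power pderiv_pCons pderiv_of_nat)
  have "deriv_point (veronese_param (n + j + i) L0 L1 L2) i j
      = poly (poly (of_nat e1 * [:[:L1:]:] ^ i * (of_nat e2 * [:[:L2:]:] ^ j * ?P ^ n)) 0) 0"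
    unfolding deriv_point_def veronese_param_def e1(2) pderiv_funpow_constant_mult[OF K] e2(2) ..
  also have "\<dots> = of_nat (e1 * e2) * (L0 ^ n * L1 ^ i * L2 ^ j)"
    by (simp add: poly_power mult_ac)
  finally show ?thesis using e1(1) e2(1) by (intro exI[of _ "e1 * e2"]) simp
qed

lemma of_nat_times_eq_scale: "of_nat e * f = scale (of_nat e) (f :: 'k::field ternary)"
  by (simp add: scale_def const_def)

text \<open>Induction on the degree: a monomial is a variable times a monomial of lower degree, and
  the variable is a combination of \<open>L0\<close>, \<open>L1\<close>, \<open>L2\<close>. Products
  are extended linearly first in the form of degree \<open>n\<close>, then in the linear
  factor.\<close>

lemma span_products_of_basis:
  fixes L0 L1 L2 :: "'k::field ternary"
  assumes L: "polys.span {L0, L1, L2} = forms 1"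
  shows "polys.span {L0 ^ a * L1 ^ i * L2 ^ j | a i j. a + i + j = n} = forms (int n)"
    (is "polys.span (?G n) = _")
proof
  have "L0 \<in> forms 1" "L1 \<in> forms 1" "L2 \<in> forms 1"
    unfolding L[symmetric] by (auto intro: polys.span_base)
  then have "L0 ^ a * L1 ^ i * L2 ^ j \<in> forms (int a + int i + int j)" for a i j
    by (intro forms_times forms_power_linear)
  then have "?G n \<subseteq> forms (int n)" by (auto simp del: of_nat_add simp: of_nat_add[symmetric])
  then show "polys.span (?G n) \<subseteq> forms (int n)" by (rule polys.span_minimal[OF _ subspace_forms])
next
  show "forms (int n) \<subseteq> polys.span (?G n)"
  proof (induction n)
    case 0
    show ?case
    proof
      fix f :: "'k ternary" assume "f \<in> forms (int 0)"
      then have "f = scale (lookup f 0) 1" using forms_0_const[of f] by (simp add: scale_def)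
      moreover have "scale (lookup f 0) 1 \<in> polys.span (?G 0)"
        by (intro polys.span_scale polys.span_base CollectI exI[of _ 0]) simp
      ultimately show "f \<in> polys.span (?G 0)" by (rule ssubst)
    qed
  next
    case (Suc n)
    have gen: "x * g \<in> polys.span (?G (Suc n))" if "x \<in> {L0, L1, L2}" "g \<in> ?G n" for x g
    proof -
      from that(2) obtain a i j where g: "g = L0 ^ a * L1 ^ i * L2 ^ j" "a + i + j = n" by auto
      have "x * g = L0 ^ Suc a * L1 ^ i * L2 ^ j \<or> x * g = L0 ^ a * L1 ^ Suc i * L2 ^ j \<or>
          x * g = L0 ^ a * L1 ^ i * L2 ^ Suc j"
        using that(1) unfolding g(1) by (auto simp: mult_ac)
      moreover have "Suc a + i + j = Suc n" "a + Suc i + j = Suc n" "a + i + Suc j = Suc n"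
        using g(2) by simp_all
      ultimately have "\<exists>a i j. x * g = L0 ^ a * L1 ^ i * L2 ^ j \<and> a + i + j = Suc n" by metis
      then show ?thesis by (intro polys.span_base CollectI)
    qed
    have sub: "polys.subspace {g. x * g \<in> polys.span (?G (Suc n))}" for x
      unfolding polys.subspace_def
      by (auto simp: distrib_left intro: polys.span_zero polys.span_add polys.span_scale)
    have gen2: "x * g \<in> polys.span (?G (Suc n))" if "x \<in> {L0, L1, L2}" "g \<in> forms (int n)" for x g
    proof -
      have "polys.span (?G n) \<subseteq> {g. x * g \<in> polys.span (?G (Suc n))}"
        using gen[OF that(1)] by (intro polys.span_minimal sub) blast
      then show ?thesis using Suc.IH that(2) by blast
    qed
    have gen3: "x * g \<in> polys.span (?G (Suc n))" if "x \<in> forms 1" "g \<in> forms (int n)" for x g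
    proof -
      have "polys.span {L0, L1, L2} \<subseteq> {x. g * x \<in> polys.span (?G (Suc n))}"
        using gen2[OF _ that(2)] by (intro polys.span_minimal sub) (auto simp: mult.commute)
      then show ?thesis using that(1) unfolding L by (auto simp: mult.commute)
    qed
    have "monomials (Suc n) \<subseteq> polys.span (?G (Suc n))"
    proof
      fix f :: "'k ternary" assume "f \<in> monomials (Suc n)"
      then obtain m where m: "f = single m 1" "total_degree m = Suc n" by (auto simp: monomials_def)
      have "\<exists>i. lookup m i > 0"
      proof (rule ccontr)
        assume "\<not> ?thesis"
        then have "total_degree m = 0" by (simp add: total_degree_def)
        with m(2) show False by simp
      qed
      then obtain i where i: "lookup m i > 0" by blast
      let ?m = "m - exponent i"
      have "total_degree ?m = n"
        using m(2) total_degree_add[of ?m "exponent i"] exponent_remove[OF i] by simp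
      then have "single ?m (1::'k) \<in> forms (int n)" using forms_single[of ?m "1::'k"] by simp
      moreover have "f = var i * single ?m 1"
        using exponent_remove[OF i] by (simp add: m(1) var_eq mult_single add.commute)
      ultimately show "f \<in> polys.span (?G (Suc n))" using gen3[OF forms_var] by simp
    qed
    then show ?case unfolding span_monomials[symmetric] by (rule polys.span_minimal) simp
  qed
qed

lemma subspace_times_image: "polys.subspace U \<Longrightarrow> polys.subspace ((*) f ` U)"
proof -
  assume U: "polys.subspace U"
  show ?thesis
    unfolding polys.subspace_def
  proof (intro conjI ballI allI)
    show "0 \<in> (*) f ` U" using polys.subspace_0[OF U] by (intro image_eqI[of _ _ 0]) auto
  next
    fix x y assume "x \<in> (*) f ` U" "y \<in> (*) f ` U"
    then obtain u v where "u \<in> U" "v \<in> U" "x = f * u" "y = f * v" by auto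
    then show "x + y \<in> (*) f ` U"
      using polys.subspace_add[OF U] by (intro image_eqI[of _ _ "u + v"]) (auto simp: distrib_left)
  next
    fix c x assume "x \<in> (*) f ` U"
    then obtain u where "u \<in> U" "x = f * u" by auto
    then show "scale c x \<in> (*) f ` U"
      using polys.subspace_scale[OF U] by (intro image_eqI[of _ _ "scale c u"]) auto
  qed
qed

text \<open>A derivative of order \<open>i + j \<le> n\<close> is a nonzero multiple of
  \<open>L0 ^ (n + k - i - j) * L1 ^ i * L2 ^ j\<close>. All of these are divisible by
  \<open>L0 ^ k\<close>, and the quotients are exactly the monomials of degree \<open>n\<close> in
  the chosen basis.\<close>

lemma span_deriv_points_veronese:
  fixes L0 L1 L2 :: "'k::field_char_0 ternary"
  assumes L: "polys.span {L0, L1, L2} = forms 1"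
  shows "polys.span {deriv_point (veronese_param (n + k) L0 L1 L2) i j | i j. i + j \<le> n}
    = (*) (L0 ^ k) ` forms (int n)" (is "polys.span ?X = ?Y")
proof
  have deriv: "\<exists>e. e \<noteq> 0 \<and> deriv_point (veronese_param (n + k) L0 L1 L2) i j
      = scale e (L0 ^ k * (L0 ^ a * L1 ^ i * L2 ^ j))" if "a + i + j = n" for a i j
  proof -
    have "n + k = a + k + j + i" using that by simp
    then obtain e :: nat where "e \<noteq> 0" "deriv_point (veronese_param (n + k) L0 L1 L2) i j
      = of_nat e * (L0 ^ (a + k) * L1 ^ i * L2 ^ j)"
      using deriv_point_veronese_param[of "a + k" j i L0 L1 L2] by metis
    then show ?thesis
      by (intro exI[of _ "of_nat e"]) (simp add: of_nat_times_eq_scale power_add mult_ac)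
  qed
  have Y: "polys.subspace ?Y" by (rule subspace_times_image[OF subspace_forms])
  have mem: "L0 ^ a * L1 ^ i * L2 ^ j \<in> forms (int n)" if "a + i + j = n" for a i j
    unfolding span_products_of_basis[OF L, symmetric] using that by (intro polys.span_base) blast
  show "polys.span ?X \<subseteq> ?Y"
  proof (rule polys.span_minimal[OF _ Y], rule subsetI)
    fix x assume "x \<in> ?X"
    then obtain i j where x: "x = deriv_point (veronese_param (n + k) L0 L1 L2) i j" "i + j \<le> n" by auto
    then have "(n - i - j) + i + j = n" by simp
    from deriv[OF this] mem[OF this] show "x \<in> ?Y"
      unfolding x(1) using polys.subspace_scale[OF Y] by (metis image_eqI)
  qed
  show "?Y \<subseteq> polys.span ?X"
  proof -
    have "polys.subspace {g. L0 ^ k * g \<in> polys.span ?X}"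
      unfolding polys.subspace_def
      by (auto simp: distrib_left intro: polys.span_zero polys.span_add polys.span_scale)
    moreover have "{L0 ^ a * L1 ^ i * L2 ^ j | a i j. a + i + j = n} \<subseteq> {g. L0 ^ k * g \<in> polys.span ?X}"
    proof
      fix g assume "g \<in> {L0 ^ a * L1 ^ i * L2 ^ j | a i j. a + i + j = n}"
      then obtain a i j where g: "g = L0 ^ a * L1 ^ i * L2 ^ j" "a + i + j = n" by auto
      from deriv[OF g(2)] obtain e where e: "e \<noteq> 0"
        "deriv_point (veronese_param (n + k) L0 L1 L2) i j = scale e (L0 ^ k * g)"
        unfolding g(1) by auto
      have "i + j \<le> n" using g(2) by simp
      then have "scale e (L0 ^ k * g) \<in> ?X" unfolding e(2)[symmetric] by blast
      then have "scale (inverse e) (scale e (L0 ^ k * g)) \<in> polys.span ?X"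
        by (intro polys.span_scale polys.span_base)
      then show "g \<in> {g. L0 ^ k * g \<in> polys.span ?X}" using e(1) by simp
    qed
    ultimately have "forms (int n) \<subseteq> {g. L0 ^ k * g \<in> polys.span ?X}"
      unfolding span_products_of_basis[OF L, symmetric] by (rule polys.span_minimal[rotated])
    then show ?thesis by auto
  qed
qed

text \<open>Supplies a chart at every point, so that the quantification over charts in
  \<open>satisfies_laplace\<close> is not vacuous.\<close>

lemma linear_form_basis_extend:
  fixes a :: "'k::field ^ 3"
  assumes "a \<noteq> 0"
  obtains L1 L2 where "polys.span {linear_form a, L1, L2} = forms 1"
proof -
  have one: "forms 1 = (forms (int 1) :: 'k ternary set)" by simp
  have fs: "forms 1 \<subseteq> polys.span (monomials 1 :: 'k ternary set)"
    using forms_subset_span_monomials[of 1] by simp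
  have "polys.independent {linear_form a}" using assms linear_form_eq_0_iff[of a] by simp
  from polys.finite_basis_extend[OF fs finite_monomials _ this] forms_linear_form[of a]
  obtain B where B: "linear_form a \<in> B" "B \<subseteq> forms 1" "forms 1 \<subseteq> polys.span B"
    "card B = polys.dim (forms 1 :: 'k ternary set)" by auto
  have "card B = 3" unfolding B(4) one dim_forms by (simp add: choose_two)
  then have "card (B - {linear_form a}) = 2" using B(1) by simp
  then obtain L1 L2 where "B - {linear_form a} = {L1, L2}" unfolding card_2_iff by auto
  then have "B = {linear_form a, L1, L2}" using B(1) by auto
  moreover have "polys.span B = forms 1"
    using B(3) polys.span_minimal[OF B(2) subspace_forms] by (rule subset_antisym[rotated])
  ultimately show ?thesis using that by simp
qed

section \<open>Ideals generated by powers of linear forms\<close>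

text \<open>The \<open>n\<close>-th power of the irrelevant ideal, described by its terms.\<close>

definition high_degree :: "nat \<Rightarrow> 'k::field ternary set" where
  "high_degree n = {f. \<forall>m. lookup f m \<noteq> 0 \<longrightarrow> n \<le> total_degree m}"

lemma subspace_high_degree: "polys.subspace (high_degree n)"
  unfolding polys.subspace_def high_degree_def
  by (auto simp: lookup_add) (metis add.right_neutral)

lemma high_degree_times:
  assumes "f \<in> high_degree m" "g \<in> high_degree n"
  shows "f * g \<in> high_degree (m + n)"
  unfolding high_degree_def
proof (intro CollectI allI impI)
  fix e assume "lookup (f * g) e \<noteq> 0"
  then obtain a b where "e = a + b" "lookup f a \<noteq> 0" "lookup g b \<noteq> 0"
    by (rule lookup_times_nonzeroE)
  then show "m + n \<le> total_degree e"
    using assms by (auto simp: high_degree_def total_degree_add intro: add_mono)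
qed

text \<open>A multiplier splits into its constant term and a rest in \<open>high_degree 1\<close>.
  The constant preserves the linear span of \<open>S\<close>, and the rest raises the degree, so the
  sums \<open>g + h\<close> already form an ideal.\<close>

lemma ideal_span_forms_decompose:
  fixes S :: "'k::field ternary set"
  assumes S: "S \<subseteq> forms (int n)" and f: "f \<in> ideal.span S"
  shows "\<exists>g\<in>polys.span S. \<exists>h\<in>high_degree (Suc n). f = g + h"
proof -
  let ?T = "{g + h | g h. g \<in> polys.span S \<and> h \<in> high_degree (Suc n)}"
  have T: "polys.subspace ?T"
    by (rule polys.subspace_sums[OF polys.subspace_span subspace_high_degree])
  have spanS: "polys.span S \<subseteq> forms (int n)" by (rule polys.span_minimal[OF S subspace_forms])
  have "r * x \<in> ?T" if x: "x \<in> ?T" for r x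
  proof -
    from x obtain g h where gh: "x = g + h" "g \<in> polys.span S" "h \<in> high_degree (Suc n)" by auto
    let ?c = "lookup r 0"
    have "r - const ?c \<in> high_degree 1"
    proof -
      have "1 \<le> total_degree m" if "lookup (r - const ?c) m \<noteq> 0" for m
      proof (rule ccontr)
        assume "\<not> 1 \<le> total_degree m"
        then have "total_degree m = 0" by simp
        then have "m = 0" by (simp only: total_degree_eq_0_iff)
        with that show False by (simp add: const_def lookup_minus)
      qed
      then show ?thesis by (simp add: high_degree_def)
    qed
    moreover have "g \<in> high_degree n"
      using gh(2) spanS by (auto simp: high_degree_def mem_forms_nat_iff)
    ultimately have "(r - const ?c) * g \<in> high_degree (Suc n)"
      using high_degree_times[of "r - const ?c" 1 g n] by simp
    moreover have "r * h \<in> high_degree (Suc n)"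
      using high_degree_times[of r 0 h "Suc n"] gh(3) by (simp add: high_degree_def)
    ultimately have "(r - const ?c) * g + r * h \<in> high_degree (Suc n)"
      by (rule polys.subspace_add[OF subspace_high_degree])
    moreover have "scale ?c g \<in> polys.span S" using gh(2) by (rule polys.span_scale)
    moreover have "r * x = scale ?c g + ((r - const ?c) * g + r * h)"
      unfolding gh(1) scale_def by (simp add: distrib_left left_diff_distrib)
    ultimately show ?thesis by blast
  qed
  then have "ideal.subspace ?T"
    using polys.subspace_0[OF T] polys.subspace_add[OF T] by (intro ideal.subspaceI)
  moreover have "S \<subseteq> ?T"
  proof
    fix x assume "x \<in> S"
    then have "x \<in> polys.span S" by (rule polys.span_base)
    then show "x \<in> ?T"
      using polys.subspace_0[OF subspace_high_degree] by (intro CollectI exI[of _ x] exI[of _ 0]) simp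
  qed
  ultimately have "ideal.span S \<subseteq> ?T" by (rule ideal.span_minimal[rotated])
  then show ?thesis using f by blast
qed

lemma ideal_span_Int_forms:
  fixes S :: "'k::field ternary set"
  assumes S: "S \<subseteq> forms (int n)"
  shows "ideal.span S \<inter> forms (int n) = polys.span S"
proof
  have spanS: "polys.span S \<subseteq> forms (int n)" by (rule polys.span_minimal[OF S subspace_forms])
  have "polys.subspace (ideal.span S)"
    unfolding polys.subspace_def scale_def
    by (auto intro: ideal.span_zero ideal.span_add ideal.span_scale)
  then have "polys.span S \<subseteq> ideal.span S" by (rule polys.span_minimal[OF ideal.span_superset])
  with spanS show "polys.span S \<subseteq> ideal.span S \<inter> forms (int n)" by blast
  show "ideal.span S \<inter> forms (int n) \<subseteq> polys.span S"
  proof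
    fix f assume f: "f \<in> ideal.span S \<inter> forms (int n)"
    then obtain g h where gh: "g \<in> polys.span S" "h \<in> high_degree (Suc n)" "f = g + h"
      using ideal_span_forms_decompose[OF S] by blast
    have "f - g \<in> forms (int n)" using f gh(1) spanS by (intro forms_diff) auto
    then have "h \<in> forms (int n)" using gh(3) by simp
    then have "h = 0" using gh(2)
      by (intro poly_mapping_eqI) (force simp: high_degree_def mem_forms_nat_iff)
    then show "f \<in> polys.span S" using gh by simp
  qed
qed

text \<open>Below the degree of the generators the quotient ring coincides with the polynomial ring;
  this identifies the source of the multiplication map.\<close>

lemma ideal_span_Int_lower_forms:
  fixes S :: "'k::field ternary set"
  assumes S: "S \<subseteq> forms (int n)" and "m < n" and f: "f \<in> ideal.span S" "f \<in> forms (int m)"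
  shows "f = 0"
proof -
  obtain g h where gh: "g \<in> polys.span S" "h \<in> high_degree (Suc n)" "f = g + h"
    using ideal_span_forms_decompose[OF S f(1)] by blast
  have "g \<in> forms (int n)" using gh(1) polys.span_minimal[OF S subspace_forms] by blast
  then have "lookup f e = 0" if "total_degree e = m" for e
  proof -
    have "lookup g e = 0" using \<open>g \<in> forms (int n)\<close> that \<open>m < n\<close> by (auto simp: mem_forms_nat_iff)
    moreover have "lookup h e = 0" using gh(2) that \<open>m < n\<close> by (force simp: high_degree_def)
    ultimately show ?thesis by (simp add: gh(3) lookup_add)
  qed
  then show ?thesis using f(2)
    by (intro poly_mapping_eqI) (auto simp: mem_forms_nat_iff)
qed

section \<open>The ranks of multiplication maps\<close>

text \<open>The degree of the powers is split into the source degree \<open>n\<close> and the range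
  \<open>k\<close>, so no subtraction of degrees occurs. A positive \<open>k\<close> puts degree
  \<open>n\<close> below the generators.\<close>

locale linear_power_ideal =
  fixes A :: "('k::field_char_0 ^ 3) set" and n k :: nat and I :: "'k ternary set"
  assumes k_pos: "0 < k"
    and A: "finite A" "0 \<notin> A"
    and I_eq: "I = ideal.span ((\<lambda>a. linear_form a ^ (n + k)) ` A)"
begin

abbreviation gens :: "'k ternary set" where
  "gens \<equiv> (\<lambda>a. linear_form a ^ (n + k)) ` A"

abbreviation mult_image :: "'k ^ 3 \<Rightarrow> 'k ternary set" where
  "mult_image p \<equiv> (*) (linear_form p ^ k) ` forms (int n)"

text \<open>The rank of multiplication on the quotient is smaller than this by
  \<open>polys.dim gens\<close>. Keeping that summand lets the same number serve for the orthogonal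
  spaces of curves.\<close>

definition rank :: "'k ^ 3 \<Rightarrow> nat" where
  "rank p = polys.dim (polys.span gens \<union> mult_image p)"

lemma gens_subset: "gens \<subseteq> forms (int (n + k))"
  using forms_power_linear[OF forms_linear_form] by blast

lemma I_forms: "I \<inter> forms (int (n + k)) = polys.span gens"
  unfolding I_eq by (rule ideal_span_Int_forms[OF gens_subset])

lemma span_gens_subset: "polys.span gens \<subseteq> forms (int (n + k))"
  by (rule polys.span_minimal[OF gens_subset subspace_forms])

lemma image_subset: "mult_image p \<subseteq> forms (int (n + k))"
proof
  fix x assume "x \<in> mult_image p"
  then obtain g where g: "g \<in> forms (int n)" "x = linear_form p ^ k * g" by auto
  from forms_times[OF forms_power_linear[OF forms_linear_form[of p]] g(1), of k]
  show "x \<in> forms (int (n + k))" unfolding g(2) by (simp add: add.commute)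
qed

lemma forms_spanned: "U \<subseteq> forms (int m) \<Longrightarrow> U \<subseteq> polys.span (monomials m)"
  by (simp add: span_monomials)

lemma dim_image: "p \<noteq> 0 \<Longrightarrow> polys.dim (mult_image p) = (n + 2) choose 2"
  using dim_times_image[of "linear_form p ^ k", OF _ subspace_forms forms_spanned[OF subset_refl] finite_monomials]
  by (simp add: linear_form_eq_0_iff dim_forms)

lemma span_gens_Un_image_subset: "polys.span gens \<union> mult_image p \<subseteq> forms (int (n + k))"
  using span_gens_subset image_subset by (rule Un_least)

lemma rank_le_forms: "rank p \<le> (n + k + 2) choose 2"
  unfolding rank_def dim_forms[symmetric, where 'k = 'k]
  by (rule polys.dim_mono_finite_span[OF _ forms_spanned[OF subset_refl] finite_monomials])
    (rule subset_trans[OF span_gens_Un_image_subset polys.span_superset])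

lemma rank_le_sum: "p \<noteq> 0 \<Longrightarrow> rank p \<le> polys.dim gens + ((n + 2) choose 2)"
  using polys.dim_Un_le[OF forms_spanned[OF span_gens_subset] forms_spanned[OF image_subset] finite_monomials, of p]
  by (simp add: rank_def dim_image)

lemma dim_gens_le_rank: "polys.dim gens \<le> rank p"
proof -
  have "gens \<subseteq> polys.span (polys.span gens \<union> mult_image p)"
    by (meson Un_upper1 polys.span_superset subset_trans)
  from polys.dim_mono_finite_span[OF this forms_spanned[OF span_gens_Un_image_subset] finite_monomials]
  show ?thesis unfolding rank_def .
qed

section \<open>Dimensions of spaces of curves by apolarity\<close>

lemma dim_forms_through: "polys.dim (forms_through A (n + k)) + polys.dim gens = (n + k + 2) choose 2"
proof -
  have "forms_through A (n + k) = {g \<in> forms (int (n + k)). \<forall>w\<in>gens. pairing w g = 0}"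
    unfolding forms_through_def by (auto simp: pairing_linear_form_power)
  moreover have "polys.dim {g \<in> forms (int (n + k)). \<forall>w\<in>gens. pairing w g = 0} + polys.dim gens
      = polys.dim (forms (int (n + k)) :: 'k ternary set)"
    by (rule polys.dim_orthogonal[OF subspace_forms forms_spanned[OF subset_refl] finite_monomials
          gens_subset pairing_add_right pairing_scale_right pairing_add_left pairing_scale_left])
      (blast intro: pairing_nondegenerate)
  ultimately show ?thesis by (simp only: dim_forms)
qed

lemma dim_forms_through_fat_point:
  "polys.dim {f \<in> forms_through A (n + k). (dir_deriv p ^^ k) f = 0} + rank p = (n + k + 2) choose 2"
proof -
  have D: "(dir_deriv p ^^ k) g = 0 \<longleftrightarrow> (\<forall>w\<in>mult_image p. pairing w g = 0)"
    if "g \<in> forms (int (n + k))" for g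
  proof
    assume "(dir_deriv p ^^ k) g = 0"
    then show "\<forall>w\<in>mult_image p. pairing w g = 0"
      by (auto simp: pairing_linear_form_power_times) (simp add: pairing_def)
  next
    assume *: "\<forall>w\<in>mult_image p. pairing w g = 0"
    have "(dir_deriv p ^^ k) g \<in> forms (int n)"
      using forms_dir_deriv_funpow[OF that, where a = p and n = k] by simp
    then show "(dir_deriv p ^^ k) g = 0"
    proof (rule pairing_nondegenerate)
      fix f :: "'k ternary" assume "f \<in> forms (int n)"
      then have "pairing (linear_form p ^ k * f) g = 0" using * by blast
      then show "pairing f ((dir_deriv p ^^ k) g) = 0"
        by (simp add: pairing_linear_form_power_times)
    qed
  qed
  have eq: "{f \<in> forms_through A (n + k). (dir_deriv p ^^ k) f = 0}
      = {g \<in> forms (int (n + k)). \<forall>w\<in>gens \<union> mult_image p. pairing w g = 0}" (is "?L = ?R")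
  proof -
    have "(\<forall>w\<in>gens. pairing w g = 0) \<longleftrightarrow> (\<forall>z\<in>A. eval g z = 0)" if "g \<in> forms (int (n + k))" for g
      using pairing_linear_form_power[OF that] by simp
    then show ?thesis unfolding forms_through_def ball_Un using D by blast
  qed
  have "polys.span (polys.span gens \<union> mult_image p) = polys.span (gens \<union> mult_image p)"
    by (simp add: polys.span_Un polys.span_span)
  then have "rank p = polys.dim (gens \<union> mult_image p)"
    unfolding rank_def by (rule polys.span_eq_dim)
  moreover have "polys.dim ?R + polys.dim (gens \<union> mult_image p) = polys.dim (forms (int (n + k)) :: 'k ternary set)"
    by (rule polys.dim_orthogonal[OF subspace_forms forms_spanned[OF subset_refl] finite_monomials
          Un_least[OF gens_subset image_subset] pairing_add_right pairing_scale_right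
          pairing_add_left pairing_scale_left])
      (blast intro: pairing_nondegenerate)
  ultimately show ?thesis unfolding eq dim_forms by simp
qed

section \<open>Maximal rank of multiplication\<close>

lemma mult_surj_iff:
  "mult_surj I (linear_form p ^ k) (int n) (int (n + k)) \<longleftrightarrow> rank p = (n + k + 2) choose 2"
proof
  assume surj: "mult_surj I (linear_form p ^ k) (int n) (int (n + k))"
  have "forms (int (n + k)) \<subseteq> polys.span (polys.span gens \<union> mult_image p)"
  proof
    fix h :: "'k ternary" assume h: "h \<in> forms (int (n + k))"
    with surj obtain g where g: "g \<in> forms (int n)" "h - linear_form p ^ k * g \<in> I"
      unfolding mult_surj_def by blast
    then have im: "linear_form p ^ k * g \<in> mult_image p" by blast
    then have "h - linear_form p ^ k * g \<in> forms (int (n + k))"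
      using h image_subset by (intro forms_diff) auto
    with g(2) have "h - linear_form p ^ k * g \<in> polys.span gens" using I_forms by blast
    then have "(h - linear_form p ^ k * g) + linear_form p ^ k * g \<in> polys.span (polys.span gens \<union> mult_image p)"
      using im by (intro polys.span_add polys.span_base) auto
    then show "h \<in> polys.span (polys.span gens \<union> mult_image p)" by simp
  qed
  then have "polys.dim (forms (int (n + k)) :: 'k ternary set) \<le> rank p"
    unfolding rank_def
    by (rule polys.dim_mono_finite_span[OF _ forms_spanned[OF span_gens_Un_image_subset] finite_monomials])
  then show "rank p = (n + k + 2) choose 2" using rank_le_forms[of p] by (simp add: dim_forms del: of_nat_add)
next
  assume rank: "rank p = (n + k + 2) choose 2"
  have "forms (int (n + k)) \<subseteq> polys.span (polys.span gens \<union> mult_image p)"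
    by (rule polys.dim_eq_imp_span_eq[OF span_gens_Un_image_subset _ forms_spanned[OF subset_refl] finite_monomials])
      (use rank in \<open>simp add: rank_def dim_forms del: of_nat_add\<close>)
  also have "\<dots> = {x + y | x y. x \<in> polys.span gens \<and> y \<in> mult_image p}"
    unfolding polys.span_Un polys.span_span
      polys.span_eq_iff[THEN iffD2, OF subspace_times_image[OF subspace_forms]] ..
  finally have *: "forms (int (n + k)) \<subseteq> {x + y | x y. x \<in> polys.span gens \<and> y \<in> mult_image p}" .
  show "mult_surj I (linear_form p ^ k) (int n) (int (n + k))"
    unfolding mult_surj_def
  proof
    fix h :: "'k ternary" assume "h \<in> forms (int (n + k))"
    with * obtain x g where x: "h = x + linear_form p ^ k * g" "x \<in> polys.span gens" "g \<in> forms (int n)"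
      by blast
    then have "h - linear_form p ^ k * g \<in> I" using I_forms by auto
    with x(3) show "\<exists>g\<in>forms (int n). h - linear_form p ^ k * g \<in> I" by blast
  qed
qed

text \<open>The ideal is zero in degree \<open>n\<close>, so the kernel is carried by the nonzero
  factor \<open>linear_form p ^ k\<close> onto the intersection of the degree \<open>n + k\<close>
  piece of the ideal with the image.\<close>

lemma mult_inj_iff:
  assumes "p \<noteq> 0"
  shows "mult_inj I (linear_form p ^ k) (int n) \<longleftrightarrow> rank p = polys.dim gens + ((n + 2) choose 2)"
proof -
  have nz: "linear_form p ^ k \<noteq> 0" using assms by (simp add: linear_form_eq_0_iff)
  have "rank p = polys.dim gens + ((n + 2) choose 2) \<longleftrightarrow> polys.span gens \<inter> mult_image p \<subseteq> {0}"
    using polys.dim_Un_eq_iff[OF polys.subspace_span forms_spanned[OF span_gens_subset]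
        subspace_times_image[OF subspace_forms] forms_spanned[OF image_subset] finite_monomials, of p]
    by (simp add: rank_def dim_image[OF assms])
  also have "\<dots> \<longleftrightarrow> mult_inj I (linear_form p ^ k) (int n)"
  proof
    assume *: "polys.span gens \<inter> mult_image p \<subseteq> {0}"
    show "mult_inj I (linear_form p ^ k) (int n)"
      unfolding mult_inj_def
    proof (intro ballI impI)
      fix g h :: "'k ternary" assume gh: "g \<in> forms (int n)" "h \<in> forms (int n)"
        "linear_form p ^ k * g - linear_form p ^ k * h \<in> I"
      then have im: "linear_form p ^ k * (g - h) \<in> mult_image p" using forms_diff by blast
      moreover have "linear_form p ^ k * (g - h) \<in> I" using gh(3) by (simp add: right_diff_distrib)
      ultimately have "linear_form p ^ k * (g - h) \<in> polys.span gens"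
        using I_forms image_subset by blast
      with im * have "linear_form p ^ k * (g - h) = 0" by blast
      with nz have "g - h = 0" unfolding mult_eq_0_iff by blast
      then show "g - h \<in> I" unfolding I_eq by (simp only: ideal.span_zero)
    qed
  next
    assume inj: "mult_inj I (linear_form p ^ k) (int n)"
    show "polys.span gens \<inter> mult_image p \<subseteq> {0}"
    proof
      fix x assume x: "x \<in> polys.span gens \<inter> mult_image p"
      then obtain g where g: "g \<in> forms (int n)" "x = linear_form p ^ k * g" by auto
      have "x \<in> I" using x I_forms by blast
      then have "linear_form p ^ k * g - linear_form p ^ k * 0 \<in> I" using g(2) by simp
      with inj g(1) have "g - 0 \<in> I" unfolding mult_inj_def using forms_zero by blast
      then have "g \<in> ideal.span gens" unfolding I_eq by simp
      then have "g = 0" using ideal_span_Int_lower_forms[OF gens_subset _ _ g(1)] k_pos by simp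
      then show "x \<in> {0}" using g(2) by simp
    qed
  qed
  finally show ?thesis by simp
qed

text \<open>Both values bound \<open>rank p\<close> from above, so missing both of them is the same
  as lying below the smaller one.\<close>

lemma not_maximal_rank_iff:
  assumes "p \<noteq> 0"
  shows "\<not> mult_inj I (linear_form p ^ k) (int n) \<and> \<not> mult_surj I (linear_form p ^ k) (int n) (int n + int k)
    \<longleftrightarrow> rank p < min (polys.dim gens + ((n + 2) choose 2)) ((n + k + 2) choose 2)"
  using mult_inj_iff[OF assms] mult_surj_iff[of p] rank_le_sum[OF assms] rank_le_forms[of p] by auto

lemma fails_SLP_iff:
  "fails_SLP I k (int n) \<longleftrightarrow>
    general_point (\<lambda>p. rank p < min (polys.dim gens + ((n + 2) choose 2)) ((n + k + 2) choose 2))"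
  unfolding fails_SLP_def by (rule iffI; erule general_point_mono) (simp_all add: not_maximal_rank_iff)

section \<open>Unexpected curves and the rank\<close>

lemma general_point_off_A: "general_point (\<lambda>p. \<forall>z\<in>A. \<forall>c. p \<noteq> c *s z)"
  by (rule general_point_Ball[OF A(1)]) (rule general_point_not_multiple)

lemma h0_points: "h0 (vanishing_ideal A) (int (n + k)) + polys.dim gens = (n + k + 2) choose 2"
  unfolding h0_def sections_vanishing_ideal[OF A(2)] by (rule dim_forms_through)

lemma h0_points_and_fat_point:
  assumes "p \<noteq> 0" "\<forall>z\<in>A. \<forall>c. p \<noteq> c *s z"
  shows "h0 (ideal_prod (vanishing_ideal A) (ideal_power (vanishing_ideal {p}) (n + 1))) (int (n + k)) + rank p
    = (n + k + 2) choose 2"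
proof -
  have "sections (ideal_prod (vanishing_ideal A) (ideal_power (vanishing_ideal {p}) (n + 1))) (int (n + k))
    = {f \<in> forms_through A (n + k). (dir_deriv p ^^ k) f = 0}"
    using sections_points_and_fat_point[OF A(2,1) assms(1), of "n + 1" "n + k"] assms(2) k_pos by simp
  then show ?thesis unfolding h0_def using dim_forms_through_fat_point by simp
qed

text \<open>Both \<open>h0\<close> are complements in the forms of degree \<open>n + k\<close>;
  subtracting from \<open>(n + k + 2) choose 2\<close> reverses the inequality and turns the maximum
  into a minimum.\<close>

lemma unexpected_iff_rank:
  assumes "p \<noteq> 0" "\<forall>z\<in>A. \<forall>c. p \<noteq> c *s z"
  shows "int (h0 (ideal_prod (vanishing_ideal A) (ideal_power (vanishing_ideal {p}) (n + 1))) (int (n + k)))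
      > max (int (h0 (vanishing_ideal A) (int (n + k))) - int ((n + 2) choose 2)) 0
    \<longleftrightarrow> rank p < min (polys.dim gens + ((n + 2) choose 2)) ((n + k + 2) choose 2)"
  using h0_points_and_fat_point[OF assms] h0_points by auto

section \<open>Laplace equations and the rank\<close>

lemma osculating_dim_veronese:
  assumes "polys.span {linear_form p, L1, L2} = forms 1"
  shows "osculating_dim I (n + k) (veronese_param (n + k) (linear_form p) L1 L2) n
    = int (rank p) - int (polys.dim gens) - 1"
  unfolding osculating_dim_def dim_mod_def span_deriv_points_veronese[OF assms] I_forms
  using dim_gens_le_rank[of p] by (simp add: rank_def Un_commute of_nat_diff)

text \<open>Adding \<open>polys.dim gens\<close>, lost in the quotient, and 1, lost by
  projectivization, turns the two expected projective dimensions into the two bounds on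
  \<open>rank\<close>.\<close>

lemma osculating_expdim_eq:
  "osculating_expdim I (n + k) n
    = int (min (polys.dim gens + ((n + 2) choose 2)) ((n + k + 2) choose 2)) - int (polys.dim gens) - 1"
proof -
  have "polys.dim (forms (int (n + k)) \<union> polys.span gens) = (n + k + 2) choose 2"
    unfolding Un_absorb2[OF span_gens_subset] by (rule dim_forms)
  moreover have "polys.dim gens \<le> (n + k + 2) choose 2" using dim_forms_through by simp
  ultimately show ?thesis
    unfolding osculating_expdim_def ambient_dim_def dim_mod_def I_forms
    by (simp add: of_nat_diff min_def)
qed

text \<open>The osculating dimension depends on \<open>p\<close> only, so all charts at
  \<open>p\<close> give the same equation.\<close>

lemma satisfies_laplace_iff:
  "satisfies_laplace I (n + k) \<delta> (int n) \<longleftrightarrow>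
    general_point (\<lambda>p. rank p + \<delta> = min (polys.dim gens + ((n + 2) choose 2)) ((n + k + 2) choose 2))"
proof -
  have "(\<forall>L1 L2. polys.span {linear_form p, L1, L2} = forms 1 \<longrightarrow>
       osculating_dim I (n + k) (veronese_param (n + k) (linear_form p) L1 L2) n
         = osculating_expdim I (n + k) n - int \<delta>)
     \<longleftrightarrow> rank p + \<delta> = min (polys.dim gens + ((n + 2) choose 2)) ((n + k + 2) choose 2)"
    (is "?L \<longleftrightarrow> ?R") if p: "p \<noteq> 0" for p
  proof -
    have "osculating_dim I (n + k) (veronese_param (n + k) (linear_form p) L1 L2) n
         = osculating_expdim I (n + k) n - int \<delta> \<longleftrightarrow> ?R"
      if "polys.span {linear_form p, L1, L2} = forms 1" for L1 L2
      unfolding osculating_dim_veronese[OF that] osculating_expdim_eq by linarith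
    moreover obtain L1 L2 where "polys.span {linear_form p, L1, L2} = forms 1"
      by (rule linear_form_basis_extend[OF p])
    ultimately show ?thesis by blast
  qed
  then show ?thesis
    unfolding satisfies_laplace_def by (auto elim!: general_point_mono)
qed

lemma rank_generic: "\<exists>r. general_point (\<lambda>p. rank p = r)"
  unfolding rank_def by (rule dim_Un_linear_form_power_generic[OF span_gens_subset image_subset])

lemma fails_SLP_iff_laplace:
  "fails_SLP I k (int n) \<longleftrightarrow> (\<exists>\<delta>\<ge>1. satisfies_laplace I (n + k) \<delta> (int n))"
proof -
  let ?e = "min (polys.dim gens + ((n + 2) choose 2)) ((n + k + 2) choose 2)"
  obtain r where r: "general_point (\<lambda>p. rank p = r)" using rank_generic by blast
  show ?thesis
    unfolding fails_SLP_iff satisfies_laplace_iff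
  proof
    \<comment> \<open>The two open sets meet, so the generic rank \<open>r\<close> itself lies below
      \<open>?e\<close>, and \<open>?e - r\<close> is the constant defect.\<close>
    assume "general_point (\<lambda>p. rank p < ?e)"
    then obtain p where "rank p < ?e" "rank p = r"
      using general_pointD[OF general_point_conj[OF _ r]] by blast
    then have "general_point (\<lambda>p. rank p + (?e - r) = ?e)"
      by (intro general_point_mono[OF r]) simp
    moreover have "?e - r \<ge> 1" using \<open>rank p < ?e\<close> \<open>rank p = r\<close> by linarith
    ultimately show "\<exists>\<delta>\<ge>1. general_point (\<lambda>p. rank p + \<delta> = ?e)" by blast
  next
    assume "\<exists>\<delta>\<ge>1. general_point (\<lambda>p. rank p + \<delta> = ?e)"
    then obtain \<delta> where "\<delta> \<ge> 1" and gen: "general_point (\<lambda>p. rank p + \<delta> = ?e)" by blast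
    then show "general_point (\<lambda>p. rank p < ?e)" by (intro general_point_mono[OF gen]) linarith
  qed
qed

end

text \<open>The degree forces \<open>j = n + 1\<close>. The comparison with \<open>rank\<close>
  holds at points off \<open>A\<close> only, so each open set is first intersected with the set of
  these points.\<close>

lemma unexpected_curve_iff_fails_SLP:
  fixes A :: "('k::field_char_0 ^ 3) set"
  assumes "finite A" "0 \<notin> A" and "I = ideal.span ((\<lambda>a. linear_form a ^ (n + 2)) ` A)"
  shows "admits_unexpected_curve A (n + 2) \<longleftrightarrow> fails_SLP I 2 (int n)"
proof -
  interpret linear_power_ideal A n 2 I
    by unfold_locales (simp_all add: assms)
  let ?U = "\<lambda>p. int (h0 (ideal_prod (vanishing_ideal A) (ideal_power (vanishing_ideal {p}) (n + 1))) (int (n + 2)))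
      > max (int (h0 (vanishing_ideal A) (int (n + 2))) - int ((n + 2) choose 2)) 0"
  have "admits_unexpected_curve A (n + 2) \<longleftrightarrow> general_point ?U"
  proof
    assume "admits_unexpected_curve A (n + 2)"
    then obtain j where j: "n + 2 = j + 1" and gen: "general_point (\<lambda>p.
         int (h0 (ideal_prod (vanishing_ideal A) (ideal_power (vanishing_ideal {p}) j)) (int (j + 1)))
         > max (int (h0 (vanishing_ideal A) (int (j + 1))) - int ((j + 1) choose 2)) 0)"
      unfolding admits_unexpected_curve_def by blast
    from j have "j = n + 1" by simp
    with gen show "general_point ?U" by (simp only: add.assoc one_add_one)
  next
    assume "general_point ?U"
    then show "admits_unexpected_curve A (n + 2)"
      unfolding admits_unexpected_curve_def by (intro exI[of _ "n + 1"]) (simp only: add.assoc one_add_one, simp)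
  qed
  also have "\<dots> \<longleftrightarrow> general_point (\<lambda>p. rank p < min (polys.dim gens + ((n + 2) choose 2)) ((n + 2 + 2) choose 2))"
    (is "_ \<longleftrightarrow> general_point ?R")
  proof
    assume "general_point ?U"
    from general_point_conj[OF this general_point_off_A] show "general_point ?R"
      by (rule general_point_mono) (use unexpected_iff_rank in blast)
  next
    assume "general_point ?R"
    from general_point_conj[OF this general_point_off_A] show "general_point ?U"
      by (rule general_point_mono) (use unexpected_iff_rank in blast)
  qed
  finally show ?thesis unfolding fails_SLP_iff .
qed

section \<open>The equivalences for the given linear forms\<close>

lemma not_general_point_False: "\<not> general_point (\<lambda>p. False)"
  using general_pointD by blast

theorem corollary25:
  fixes l :: "nat \<Rightarrow> 'k::{alg_closed_field, field_char_0} ternary"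
    and d :: nat
    and I :: "'k ternary set"
    and Z :: "('k ^ 3) set"
  assumes "d \<ge> 1"
    and "\<And>i. i < 2 * d + 1 \<Longrightarrow> l i \<in> forms 1 \<and> l i \<noteq> 0"
    and "\<And>i j c. i < 2 * d + 1 \<Longrightarrow> j < 2 * d + 1 \<Longrightarrow> i \<noteq> j \<Longrightarrow> l i \<noteq> scale c (l j)"
    and "I = ideal.span ((\<lambda>i. l i ^ d) ` {..<2 * d + 1})"
    and "artinian_ideal I"
    and "Z = (\<lambda>i. dual_point (l i)) ` {..<2 * d + 1}"
    and "\<And>S. S \<subseteq> Z \<Longrightarrow> aligned S \<Longrightarrow> card S \<le> d + 1"
  shows "(admits_unexpected_curve Z d \<longleftrightarrow> fails_SLP I 2 (int d - 2)) \<and>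
         (fails_SLP I 2 (int d - 2) \<longleftrightarrow> (\<exists>\<delta>\<ge>1. satisfies_laplace I d \<delta> (int d - 2)))"
proof (cases "d = 1")
  \<comment> \<open>All three conditions fail for \<open>d = 1\<close>: multiplication from the zero
    space in degree \<open>- 1\<close> is injective, degree 1 would force \<open>j = 0\<close>, and
    the order \<open>- 1\<close> is negative.\<close>
  case True
  have "mult_inj I f (- 1)" for f :: "'k ternary"
  proof -
    have "g = 0" if "g \<in> forms (- 1)" for g :: "'k ternary"
      using forms_negative[OF _ that] by simp
    moreover have "0 \<in> I" unfolding assms(4) by (rule ideal.span_zero)
    ultimately show ?thesis unfolding mult_inj_def by (metis diff_self)
  qed
  then have "\<not> fails_SLP I 2 (- 1)" unfolding fails_SLP_def by (simp add: not_general_point_False)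
  moreover have "\<not> admits_unexpected_curve Z 1" unfolding admits_unexpected_curve_def by simp
  moreover have "\<not> satisfies_laplace I 1 \<delta> (- 1)" for \<delta> by (simp add: satisfies_laplace_def)
  ultimately show ?thesis using True by simp
next
  case False
  define n where "n = d - 2"
  have d: "d = n + 2" using False assms(1) by (simp add: n_def)
  have dual: "linear_form (dual_point (l i)) = l i" "dual_point (l i) \<noteq> 0" if "i < 2 * d + 1" for i
  proof -
    show *: "linear_form (dual_point (l i)) = l i"
      using assms(2)[OF that] by (simp add: linear_form_dual_point)
    show "dual_point (l i) \<noteq> 0"
      using assms(2)[OF that] linear_form_eq_0_iff[of "dual_point (l i)"] * by simp
  qed
  have Z: "finite Z" "0 \<notin> Z" unfolding assms(6) using dual(2) by force+
  \<comment> \<open>Each form is recovered from the coordinates of its dual point, so the generators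
    can be indexed by the set \<open>Z\<close> instead of by numbers.\<close>
  have "(\<lambda>i. l i ^ d) ` {..<2 * d + 1} = (\<lambda>a. linear_form a ^ (n + 2)) ` Z"
    unfolding assms(6) image_image by (intro image_cong) (simp_all only: dual(1) d[symmetric] lessThan_iff)
  then have I: "I = ideal.span ((\<lambda>a. linear_form a ^ (n + 2)) ` Z)" using assms(4) by simp
  interpret linear_power_ideal Z n 2 I
    by unfold_locales (simp_all add: Z I)
  show ?thesis
    using unexpected_curve_iff_fails_SLP[OF Z I] fails_SLP_iff_laplace by (simp add: d)
qed

end
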